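(* Let $\dim X=\infty$. Then the following assertions are equivalent. a) $\mathcal{A}$ has compact resolvent. b) $\mathbb{A}_0$ has compact resolvent. c) $\partial X$ is finite dimensional and the embeddings $[D(A_0)]\hookrightarrow Y$ and $Y\hookrightarrow X$ are compact.
   Context: Standing assumptions: $X$, $Y$, $\partial X$ are Banach spaces ($\partial X$ is just the name of a third Banach space) with $Y\hookrightarrow X$ (continuous embedding). $A:D(A)\to X$ is linear with $D(A)\subset Y$; $R:D(A)\to\partial X$ is linear and surjective; $B_1,B_2\in\mathcal{L}(Y,\partial X)$; $B_3,B_4\in\mathcal{L}(\partial X)$; the operator $\binom{A}{R}:D(A)\subset Y\to X\times\partial X$, $u\mapsto(Au,Ru)$, is closed; the restriction $A_0:=A|_{\ker R}$ generates a cosine operator function with associated phase space $Y\times X$ (i.e. the operator matrix $\begin{pmatrix} 0 & I_Y \\ A_0 & 0 \end{pmatrix}$ with domain $D(A_0)\times Y$ generates a strongly continuous group on $Y\times X$). Put $L:=R+B_2:D(A)\to\partial X$. $[D(A_0)]$ denotes $D(A_0)$ with the graph norm. On $\mathbb{X}=Y\times X\times\partial X$ the operator $\mathbb{A}_0$ is $$\mathbb{A}_0(u,v,x)=(v,A_0u,B_2u),\qquad D(\mathbb{A}_0)=D(A_0)\times Y\times\partial X.$$ On $\mathcal{X}=Y\times X\times\partial X\times\partial X$ the operator $\mathcal{A}$ is $$\mathcal{A}(u,v,x,y)=\left(v,\,Au,\,Lu,\,(B_1+B_4B_2)u+B_3x+B_4y\right),$$ $$D(\mathcal{A})=\{(u,v,x,y)\in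 D(A)\times Y\times\partial X\times\partial X:Ru=y\}.$$ *)

theory Defs
  imports "HOL-Analysis.Analysis"
begin

text \<open>
  A Banach space over a scalar field \<open>'k\<close> is a type of class \<^class>\<open>banach\<close> together with a scalar
  multiplication that extends the real one and is compatible with the norm. The scalar field is
  a type of the classes \<^class>\<open>real_normed_field\<close> and \<^class>\<open>euclidean_space\<close>, that is, a
  finite-dimensional real normed field, hence (up to isometric isomorphism) the real or the
  complex numbers. So real and complex Banach spaces are treated simultaneously.
\<close>

definition banach_space_over ::
    "('k::{real_normed_field,euclidean_space} \<Rightarrow> 'a::banach \<Rightarrow> 'a) \<Rightarrow> bool" where
  "banach_space_over s \<longleftrightarrow>
     vector_space s \<and>
     (\<forall>r x. s (of_real r) x = r *\<^sub>R x) \<and>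
     (\<forall>c x. norm (s c x) = norm c * norm x)"

lemma banach_space_over_scaleR: "banach_space_over (scaleR :: real \<Rightarrow> 'a::banach \<Rightarrow> 'a)"
  by (simp add: banach_space_over_def real_vector.vector_space_axioms)

lemma banach_space_over_complex: "banach_space_over ((*) :: complex \<Rightarrow> complex \<Rightarrow> complex)"
  by (auto simp: banach_space_over_def norm_mult scaleR_conv_of_real algebra_simps
      intro!: vector_space.intro)

definition finite_dimensional ::
    "('k::field \<Rightarrow> 'a::ab_group_add \<Rightarrow> 'a) \<Rightarrow> bool" where
  "finite_dimensional s \<longleftrightarrow> (\<exists>B. finite B \<and> module.span s B = UNIV)"

definition bounded_operator ::
    "('k \<Rightarrow> 'a \<Rightarrow> 'a) \<Rightarrow> ('k \<Rightarrow> 'b \<Rightarrow> 'b)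
      \<Rightarrow> ('a::real_normed_vector \<Rightarrow> 'b::real_normed_vector) \<Rightarrow> bool" where
  "bounded_operator s1 s2 f \<longleftrightarrow>
     bounded_linear f \<and> (\<forall>c x. f (s1 c x) = s2 c (f x))"

text \<open>
  A possibly unbounded operator is given by its domain \<open>D\<close> and a total function \<open>T\<close>, whose values
  outside \<open>D\<close> are irrelevant.
\<close>

definition linear_operator ::
    "('k::field \<Rightarrow> 'a \<Rightarrow> 'a) \<Rightarrow> ('k \<Rightarrow> 'b \<Rightarrow> 'b)
      \<Rightarrow> 'a::ab_group_add set \<Rightarrow> ('a \<Rightarrow> 'b::ab_group_add) \<Rightarrow> bool" where
  "linear_operator s1 s2 D T \<longleftrightarrow>
     module.subspace s1 D \<and>
     (\<forall>u\<in>D. \<forall>v\<in>D. T (u + v) = T u + T v) \<and>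
     (\<forall>c. \<forall>u\<in>D. T (s1 c u) = s2 c (T u))"

definition closed_operator ::
    "'a::real_normed_vector set \<Rightarrow> ('a \<Rightarrow> 'b::real_normed_vector) \<Rightarrow> bool" where
  "closed_operator D T \<longleftrightarrow> closed {(u, T u) | u. u \<in> D}"

definition resolvent ::
    "('k \<Rightarrow> 'a \<Rightarrow> 'a) \<Rightarrow> 'a set \<Rightarrow> ('a \<Rightarrow> 'a) \<Rightarrow> 'k \<Rightarrow> 'a \<Rightarrow> 'a::real_normed_vector" where
  "resolvent s D T z = inv_into D (\<lambda>u. s z u - T u)"

definition resolvent_set ::
    "('k \<Rightarrow> 'a \<Rightarrow> 'a) \<Rightarrow> 'a::real_normed_vector set \<Rightarrow> ('a \<Rightarrow> 'a) \<Rightarrow> 'k set" where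
  "resolvent_set s D T =
     {z. bij_betw (\<lambda>u. s z u - T u) D UNIV \<and> bounded_operator s s (resolvent s D T z)}"

text \<open>
  Compactness of a linear map \<open>f\<close> defined on the space \<open>D\<close> normed by \<open>nrm\<close>; with \<open>f\<close> an inclusion
  map this is compactness of an embedding.
\<close>

definition compact_map ::
    "'a set \<Rightarrow> ('a \<Rightarrow> real) \<Rightarrow> ('a \<Rightarrow> 'b::real_normed_vector) \<Rightarrow> bool" where
  "compact_map D nrm f \<longleftrightarrow> compact (closure (f ` {u \<in> D. nrm u \<le> 1}))"

definition has_compact_resolvent ::
    "('k \<Rightarrow> 'a \<Rightarrow> 'a) \<Rightarrow> 'a::real_normed_vector set \<Rightarrow> ('a \<Rightarrow> 'a) \<Rightarrow> bool" where
  "has_compact_resolvent s D T \<longleftrightarrow>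
     resolvent_set s D T \<noteq> {} \<and>
     (\<forall>z\<in>resolvent_set s D T. compact_map UNIV norm (resolvent s D T z))"

definition strongly_continuous_group ::
    "('k \<Rightarrow> 'a \<Rightarrow> 'a) \<Rightarrow> (real \<Rightarrow> 'a \<Rightarrow> 'a::real_normed_vector) \<Rightarrow> bool" where
  "strongly_continuous_group s S \<longleftrightarrow>
     (\<forall>t. bounded_operator s s (S t)) \<and>
     S 0 = id \<and>
     (\<forall>t r. S (t + r) = S t \<circ> S r) \<and>
     (\<forall>x. continuous_on UNIV (\<lambda>t. S t x))"

definition generates_group ::
    "('k \<Rightarrow> 'a \<Rightarrow> 'a) \<Rightarrow> 'a::real_normed_vector set \<Rightarrow> ('a \<Rightarrow> 'a) \<Rightarrow> bool" where
  "generates_group s D T \<longleftrightarrow>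
     (\<exists>S. strongly_continuous_group s S \<and>
        (\<forall>x y. (x \<in> D \<and> T x = y) \<longleftrightarrow>
          ((\<lambda>h. (S h x - x) /\<^sub>R h) \<longlongrightarrow> y) (at 0)))"

abbreviation scale2 ::
    "('k::field \<Rightarrow> 'a::ab_group_add \<Rightarrow> 'a) \<Rightarrow> ('k \<Rightarrow> 'b::ab_group_add \<Rightarrow> 'b)
      \<Rightarrow> 'k \<Rightarrow> 'a \<times> 'b \<Rightarrow> 'a \<times> 'b" where
  "scale2 s1 s2 \<equiv> module_prod.scale s1 s2"

text \<open>
  A continuous embedding of \<open>Y\<close> into \<open>X\<close> is an injective bounded operator \<open>j\<close>. An element \<open>u\<close> of
  \<open>Y\<close>, regarded as an element of \<open>X\<close>, is thus \<open>j u\<close>; conversely an element \<open>w\<close> of \<open>X\<close> that belongs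
  to \<open>Y\<close>, i.e. lies in the range of \<open>j\<close>, is regarded as an element of \<open>Y\<close> via \<open>inv j w\<close>.
  Subspaces of \<open>Y\<close>, such as the domain of \<open>A\<close>, are sets over the type of \<open>Y\<close>.
\<close>

definition continuous_embedding ::
    "('k \<Rightarrow> 'a \<Rightarrow> 'a) \<Rightarrow> ('k \<Rightarrow> 'b \<Rightarrow> 'b)
      \<Rightarrow> ('a::real_normed_vector \<Rightarrow> 'b::real_normed_vector) \<Rightarrow> bool" where
  "continuous_embedding s1 s2 j \<longleftrightarrow> bounded_operator s1 s2 j \<and> inj j"

text \<open>The domain of the restriction of \<open>A\<close> to the kernel of \<open>R\<close>.\<close>

definition ker_dom :: "'y set \<Rightarrow> ('y \<Rightarrow> 'd::zero) \<Rightarrow> 'y set" where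
  "ker_dom DA R = {u \<in> DA. R u = 0}"

text \<open>The operator matrix with rows \<open>(0, I)\<close> and \<open>(A\<^sub>0, 0)\<close> on \<open>Y \<times> X\<close>, where \<open>D\<^sub>0\<close> is the domain of \<open>A\<^sub>0\<close>.\<close>

definition phase_dom :: "('y \<Rightarrow> 'x) \<Rightarrow> 'y set \<Rightarrow> ('y \<times> 'x) set" where
  "phase_dom j D0 = {(u, j v) | u v. u \<in> D0}"

definition phase_op :: "('y \<Rightarrow> 'x) \<Rightarrow> ('y \<Rightarrow> 'x) \<Rightarrow> 'y \<times> 'x \<Rightarrow> 'y \<times> 'x" where
  "phase_op j A0 = (\<lambda>(u, w). (inv j w, A0 u))"

definition generates_cosine_function ::
    "('k::field \<Rightarrow> 'y \<Rightarrow> 'y) \<Rightarrow> ('k \<Rightarrow> 'x \<Rightarrow> 'x)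
      \<Rightarrow> ('y::real_normed_vector \<Rightarrow> 'x::real_normed_vector) \<Rightarrow> 'y set \<Rightarrow> ('y \<Rightarrow> 'x) \<Rightarrow> bool" where
  "generates_cosine_function sY sX j D0 A0 \<longleftrightarrow>
     generates_group (scale2 sY sX) (phase_dom j D0) (phase_op j A0)"

text \<open>
  The operator matrix acting on \<open>Y \<times> X \<times> \<partial>X\<close> (decoupled from the boundary values of \<open>A\<close>) and the
  one acting on \<open>Y \<times> X \<times> \<partial>X \<times> \<partial>X\<close>, each with its domain. Norms on product types are Euclidean
  combinations of the component norms. In the third component of the latter operator,
  \<open>R u + B2 u\<close> is \<open>L u\<close>.
\<close>

definition bbA0_dom :: "('y \<Rightarrow> 'x) \<Rightarrow> 'y set \<Rightarrow> ('y \<Rightarrow> 'd::zero) \<Rightarrow> ('y \<times> 'x \<times> 'd) set" where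
  "bbA0_dom j DA R = {(u, j v, x) | u v x. u \<in> ker_dom DA R}"

definition bbA0 ::
    "('y \<Rightarrow> 'x) \<Rightarrow> ('y \<Rightarrow> 'x) \<Rightarrow> ('y \<Rightarrow> 'd) \<Rightarrow> 'y \<times> 'x \<times> 'd \<Rightarrow> 'y \<times> 'x \<times> 'd" where
  "bbA0 j A B2 = (\<lambda>(u, w, x). (inv j w, A u, B2 u))"

definition calA_dom ::
    "('y \<Rightarrow> 'x) \<Rightarrow> 'y set \<Rightarrow> ('y \<Rightarrow> 'd) \<Rightarrow> ('y \<times> 'x \<times> 'd \<times> 'd) set" where
  "calA_dom j DA R = {(u, j v, x, y) | u v x y. u \<in> DA \<and> R u = y}"

definition calA ::
    "('y \<Rightarrow> 'x) \<Rightarrow> ('y \<Rightarrow> 'x) \<Rightarrow> ('y \<Rightarrow> 'd::plus) \<Rightarrow> ('y \<Rightarrow> 'd) \<Rightarrow> ('y \<Rightarrow> 'd) \<Rightarrow> ('d \<Rightarrow> 'd) \<Rightarrow> ('d \<Rightarrow> 'd)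
      \<Rightarrow> 'y \<times> 'x \<times> 'd \<times> 'd \<Rightarrow> 'y \<times> 'x \<times> 'd \<times> 'd" where
  "calA j A R B1 B2 B3 B4 =
     (\<lambda>(u, w, x, y).
        (inv j w,
         A u,
         R u + B2 u,
         B1 u + B4 (B2 u) + B3 x + B4 y))"

end

theory Submission
  imports Defs
begin

text \<open>
  An operator with a nonempty resolvent set has compact resolvent if and only if its domain, with the
  graph norm, embeds compactly into the space (\<open>has_compact_resolvent_iff_compact_embedding\<close>). This
  splits every assertion about the two operator matrices into the existence of one resolvent point and
  the compactness of one embedding.

  The embeddings are elementary. The graph space of \<open>\<bbbA>\<^sub>0\<close> embeds into that of \<open>\<A>\<close> by
  \<open>(u, v, x) \<mapsto> (u, v, x, 0)\<close>, so compactness passes from \<open>\<A>\<close> to \<open>\<bbbA>\<^sub>0\<close>. Testing \<open>\<bbbA>\<^sub>0\<close> on vectors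
  with a single nonzero component gives the two compact embeddings and, by Riesz's theorem, the finite
  dimension of \<open>\<partial>X\<close>. Conversely, if \<open>\<partial>X\<close> is finite-dimensional, then \<open>R\<close> has a linear right inverse
  \<open>E\<close> for which \<open>E\<close> and \<open>A E\<close> are bounded, and the splitting \<open>u = (u - E R u) + E R u\<close> reduces
  compactness for \<open>\<A>\<close> to compactness for \<open>A\<^sub>0\<close>.

  The resolvent points come from the group generated by the phase operator \<open>P\<close> of \<open>A\<^sub>0\<close>. Its resolvents
  at large real \<open>l\<close> exist and decay like \<open>1/l\<close> (\<open>generator_linear_and_resolvent_decay\<close>). This property,
  \<open>resolvent_decay\<close>, is stable under bounded perturbations, under extension by the zero operator on a
  further factor, and under similarities. Now \<open>\<bbbA>\<^sub>0\<close> is a bounded perturbation of \<open>P\<close> extended by zero,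
  and so is \<open>\<A>\<close> after the change of coordinates \<open>u \<mapsto> u - E y\<close>, which turns the coupled domain
  condition \<open>R u = y\<close> into \<open>R u = 0\<close>.

  Only real resolvent points are constructed this way; the general scalar field enters through the
  linearity of resolvents and through finite dimension, which has the same meaning over the reals.
\<close>

section \<open>Uniform boundedness\<close>

text \<open>
  By Baire's theorem one of the closed sets on which all operators are bounded by \<open>n\<close> contains a
  ball; differences of points of that ball give a uniform bound near \<open>0\<close>.
\<close>

lemma uniform_boundedness_principle:
  fixes F :: "'i \<Rightarrow> 'a::banach \<Rightarrow> 'b::real_normed_vector"
  assumes lin: "\<And>i. i \<in> I \<Longrightarrow> bounded_linear (F i)"
    and bdd: "\<And>x. bounded ((\<lambda>i. F i x) ` I)"
  shows "\<exists>M>0. \<forall>i\<in>I. \<forall>x. norm (F i x) \<le> M * norm x"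
proof -
  define E where "E n = {x. \<forall>i\<in>I. norm (F i x) \<le> real n}" for n
  have closed_E: "closed (E n)" for n
  proof -
    have "E n = (\<Inter>i\<in>I. {x. norm (F i x) \<le> real n})"
      by (auto simp: E_def)
    moreover have "closed {x. norm (F i x) \<le> real n}" if "i \<in> I" for i
      by (intro closed_Collect_le continuous_intros bounded_linear.continuous_on[OF lin[OF that]])
    ultimately show ?thesis by auto
  qed
  have "\<exists>n. x \<in> E n" for x
  proof -
    obtain K where "\<And>i. i \<in> I \<Longrightarrow> norm (F i x) \<le> K"
      using bdd[of x] by (auto simp: bounded_iff)
    moreover obtain n where "K \<le> real n" using real_arch_simple by blast
    ultimately show ?thesis unfolding E_def by (blast intro: order_trans)
  qed
  then have cover: "\<Union>(range E) = UNIV" by auto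
  have "\<exists>n. interior (E n) \<noteq> {}"
  proof (rule ccontr)
    assume "\<nexists>n. interior (E n) \<noteq> {}"
    then have "euclidean interior_of \<Union>(range E) = {}"
      using closed_E by (intro Baire_category_alt disjI1 completely_metrizable_space_euclidean) auto
    then show False using cover by simp
  qed
  then obtain n x0 where "x0 \<in> interior (E n)" by blast
  then obtain r where r: "r > 0" "ball x0 r \<subseteq> E n" by (meson mem_interior)
  have small: "norm (F i y) \<le> 2 * real n" if "i \<in> I" "norm y < r" for i y
  proof -
    have "x0 + y \<in> E n" "x0 \<in> E n" using r that by (auto simp: subset_iff dist_norm)
    then have "norm (F i (x0 + y)) \<le> n" "norm (F i x0) \<le> n" using that by (auto simp: E_def)
    moreover have "F i y = F i (x0 + y) - F i x0"
      using lin[OF that(1)] by (simp add: linear_simps)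
    ultimately show ?thesis by (smt (verit) norm_triangle_ineq4)
  qed
  have "norm (F i x) \<le> (4 * real n / r + 1) * norm x" if i: "i \<in> I" for i x
  proof (cases "x = 0")
    case True
    then show ?thesis using lin[OF i] by (simp add: linear_simps)
  next
    case False
    have "norm (F i ((r / (2 * norm x)) *\<^sub>R x)) \<le> 2 * real n"
      using False r by (intro small i) auto
    then have "r / (2 * norm x) * norm (F i x) \<le> 2 * real n"
      using lin[OF i] r by (simp add: linear_simps)
    then have "norm (F i x) \<le> 4 * real n / r * norm x"
      using False r by (simp add: field_simps)
    then show ?thesis by (simp add: algebra_simps add_increasing)
  qed
  moreover have "4 * real n / r + 1 > 0" using r by (simp add: add_nonneg_pos)
  ultimately show ?thesis by blast
qed

section \<open>Finite-dimensional normed spaces\<close>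

text \<open>
  The compact sets that play the part of closed boxes in coordinates: each further basis vector adds
  the compact segment \<open>{t b | \<bar>t\<bar> \<le> K}\<close>, and sums of compact sets are compact.
\<close>

lemma compact_bounded_combinations:
  fixes B :: "'a::real_normed_vector set"
  assumes "finite B"
  shows "compact {(\<Sum>b\<in>B. c b *\<^sub>R b) | c. \<forall>b\<in>B. \<bar>c b\<bar> \<le> K}"
  using assms
proof (induction B)
  case empty
  then show ?case by simp
next
  case (insert b B)
  let ?S = "{(\<Sum>b\<in>B. c b *\<^sub>R b) | c. \<forall>b\<in>B. \<bar>c b\<bar> \<le> K}"
  let ?L = "(\<lambda>t. t *\<^sub>R b) ` {-K..K}"
  have "compact ?L"
    by (intro compact_continuous_image continuous_intros compact_Icc)
  then have "compact {x + y | x y. x \<in> ?L \<and> y \<in> ?S}"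
    using insert.IH by (rule compact_sums)
  also have "{x + y | x y. x \<in> ?L \<and> y \<in> ?S} =
      {(\<Sum>b\<in>insert b B. c b *\<^sub>R b) | c. \<forall>b\<in>insert b B. \<bar>c b\<bar> \<le> K}" (is "?lhs = ?rhs")
  proof (rule set_eqI, rule iffI)
    fix z assume "z \<in> ?lhs"
    then obtain x y where xy: "z = x + y" "x \<in> ?L" "y \<in> ?S" by blast
    obtain t where "x = t *\<^sub>R b" "t \<in> {-K..K}" using xy(2) by blast
    moreover obtain c where "y = (\<Sum>b\<in>B. c b *\<^sub>R b)" "\<forall>b\<in>B. \<bar>c b\<bar> \<le> K" using xy(3) by blast
    ultimately have t: "\<bar>t\<bar> \<le> K" "\<forall>b\<in>B. \<bar>c b\<bar> \<le> K" "z = t *\<^sub>R b + (\<Sum>b\<in>B. c b *\<^sub>R b)"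
      using xy(1) by (auto simp: abs_le_iff)
    have "(\<Sum>x\<in>B. (c(b := t)) x *\<^sub>R x) = (\<Sum>x\<in>B. c x *\<^sub>R x)"
      using insert.hyps by (intro sum.cong) auto
    then have "z = (\<Sum>x\<in>insert b B. (c(b := t)) x *\<^sub>R x)"
      using t insert.hyps by simp
    moreover have "\<forall>x\<in>insert b B. \<bar>(c(b := t)) x\<bar> \<le> K" using t by auto
    ultimately show "z \<in> ?rhs" by blast
  next
    fix z assume "z \<in> ?rhs"
    then obtain c where c: "z = (\<Sum>b\<in>insert b B. c b *\<^sub>R b)" "\<forall>b\<in>insert b B. \<bar>c b\<bar> \<le> K" by blast
    then have "z = c b *\<^sub>R b + (\<Sum>b\<in>B. c b *\<^sub>R b)" using insert.hyps by simp
    moreover have "c b *\<^sub>R b \<in> ?L" using c by (auto simp: abs_le_iff)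
    ultimately show "z \<in> ?lhs" using c(2) by blast
  qed
  finally show ?case .
qed

text \<open>
  A convergent sequence in the span is bounded, so its coefficients can be chosen bounded and it lives
  in one compact set of combinations, which contains the limit.
\<close>

lemma closed_span_if_coefficients_bounded:
  fixes B :: "'a::real_normed_vector set"
  assumes "finite B" and "C \<ge> 0"
    and coeff: "\<And>x. x \<in> span B \<Longrightarrow> \<exists>c. x = (\<Sum>b\<in>B. c b *\<^sub>R b) \<and> (\<forall>b\<in>B. \<bar>c b\<bar> \<le> C * norm x)"
  shows "closed (span B)"
  unfolding closed_sequential_limits
proof (intro allI impI, elim conjE)
  fix f :: "nat \<Rightarrow> 'a" and l
  assume f: "\<forall>n. f n \<in> span B" and l: "f \<longlonglongrightarrow> l"
  obtain r where r: "\<And>n. norm (f n) \<le> r"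
    using convergent_imp_Bseq[of f] l by (auto simp: convergent_def Bseq_def)
  let ?S = "{(\<Sum>b\<in>B. c b *\<^sub>R b) | c. \<forall>b\<in>B. \<bar>c b\<bar> \<le> C * r}"
  have "f n \<in> ?S" for n
  proof -
    obtain c where "f n = (\<Sum>b\<in>B. c b *\<^sub>R b)" "\<forall>b\<in>B. \<bar>c b\<bar> \<le> C * norm (f n)"
      using coeff f by blast
    moreover have "C * norm (f n) \<le> C * r" using r \<open>C \<ge> 0\<close> by (rule mult_left_mono)
    ultimately show ?thesis by (auto intro: order_trans)
  qed
  moreover have "closed ?S"
    using compact_bounded_combinations[OF \<open>finite B\<close>] by (rule compact_imp_closed)
  ultimately have "l \<in> ?S" using l closed_sequentially by blast
  then show "l \<in> span B" by (auto intro: span_sum span_scale span_base)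
qed

text \<open>
  This is the equivalence of norms on a finite-dimensional space, in the form of a coefficient
  estimate that also makes sense for linearly dependent generators. In the induction step the span
  generated so far is closed by the induction hypothesis, so a new vector outside it has positive
  distance \<open>\<delta>\<close> from it, and its coefficient in \<open>x\<close> is at most \<open>norm x / \<delta>\<close>.
\<close>

lemma finite_span_coefficients_bounded:
  fixes B :: "'a::real_normed_vector set"
  assumes "finite B"
  shows "\<exists>C\<ge>0. \<forall>x\<in>span B. \<exists>c. x = (\<Sum>b\<in>B. c b *\<^sub>R b) \<and> (\<forall>b\<in>B. \<bar>c b\<bar> \<le> C * norm x)"
  using assms
proof (induction B)
  case empty
  then show ?case by auto
next
  case (insert b B)
  then obtain C where C: "C \<ge> 0"
    "\<And>x. x \<in> span B \<Longrightarrow> \<exists>c. x = (\<Sum>b\<in>B. c b *\<^sub>R b) \<and> (\<forall>b\<in>B. \<bar>c b\<bar> \<le> C * norm x)"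
    by blast
  show ?case
  proof (cases "b \<in> span B")
    case True
    have "\<exists>c. x = (\<Sum>b\<in>insert b B. c b *\<^sub>R b) \<and> (\<forall>b\<in>insert b B. \<bar>c b\<bar> \<le> C * norm x)"
      if "x \<in> span (insert b B)" for x
    proof -
      have "x \<in> span B" using that True by (simp add: span_redundant)
      then obtain c where c: "x = (\<Sum>b\<in>B. c b *\<^sub>R b)" "\<forall>b\<in>B. \<bar>c b\<bar> \<le> C * norm x"
        using C by blast
      have "(\<Sum>x\<in>B. (c(b := 0)) x *\<^sub>R x) = (\<Sum>x\<in>B. c x *\<^sub>R x)"
        using insert.hyps by (intro sum.cong) auto
      then show ?thesis using c insert.hyps C(1) by (intro exI[of _ "c(b := 0)"]) auto
    qed
    then show ?thesis using C(1) by blast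
  next
    case False
    have "closed (span B)"
      using closed_span_if_coefficients_bounded[OF insert.hyps(1) C] .
    define \<delta> where "\<delta> = infdist b (span B)"
    have "\<delta> > 0"
      using False \<open>closed (span B)\<close> in_closed_iff_infdist_zero[of "span B" b] span_zero[of B]
      unfolding \<delta>_def by (metis empty_iff infdist_nonneg less_le)
    define C' where "C' = max (1 / \<delta>) (C * (1 + norm b / \<delta>))"
    have "\<exists>c. x = (\<Sum>b\<in>insert b B. c b *\<^sub>R b) \<and> (\<forall>b\<in>insert b B. \<bar>c b\<bar> \<le> C' * norm x)"
      if x_in: "x \<in> span (insert b B)" for x
    proof -
      obtain k where k: "x - k *\<^sub>R b \<in> span B" using x_in span_breakdown_eq by blast
      define s where "s = x - k *\<^sub>R b"
      have "\<bar>k\<bar> * \<delta> \<le> norm x"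
      proof (cases "k = 0")
        case False
        have "- (1 / k) *\<^sub>R s \<in> span B" using k unfolding s_def by (rule span_scale)
        then have "\<delta> \<le> dist b (- (1 / k) *\<^sub>R s)" unfolding \<delta>_def by (rule infdist_le)
        then have "\<bar>k\<bar> * \<delta> \<le> \<bar>k\<bar> * norm (b + (1 / k) *\<^sub>R s)"
          by (intro mult_left_mono) (auto simp: dist_norm)
        also have "\<dots> = norm (k *\<^sub>R (b + (1 / k) *\<^sub>R s))" by simp
        also have "k *\<^sub>R (b + (1 / k) *\<^sub>R s) = x"
          using False by (simp add: s_def algebra_simps)
        finally show ?thesis .
      qed auto
      then have kx: "\<bar>k\<bar> \<le> 1 / \<delta> * norm x" using \<open>\<delta> > 0\<close> by (simp add: field_simps)
      have "norm s \<le> norm x + \<bar>k\<bar> * norm b"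
        unfolding s_def by (metis norm_scaleR norm_triangle_ineq4)
      also have "\<bar>k\<bar> * norm b \<le> 1 / \<delta> * norm x * norm b" using kx by (intro mult_right_mono) auto
      finally have "norm s \<le> (1 + norm b / \<delta>) * norm x" by (simp add: algebra_simps)
      then have "C * norm s \<le> C * ((1 + norm b / \<delta>) * norm x)"
        using C(1) by (rule mult_left_mono)
      then have sC: "C * norm s \<le> C * (1 + norm b / \<delta>) * norm x" by (simp add: mult.assoc)
      obtain c where c: "s = (\<Sum>b\<in>B. c b *\<^sub>R b)" "\<forall>b\<in>B. \<bar>c b\<bar> \<le> C * norm s"
        using C(2)[of s] k by (auto simp: s_def)
      have "(\<Sum>x\<in>B. (c(b := k)) x *\<^sub>R x) = s"
        unfolding c(1) using insert.hyps by (intro sum.cong) auto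
      then have "x = (\<Sum>x\<in>insert b B. (c(b := k)) x *\<^sub>R x)"
        using insert.hyps by (simp add: s_def)
      moreover have "1 / \<delta> * norm x \<le> C' * norm x" "C * (1 + norm b / \<delta>) * norm x \<le> C' * norm x"
        unfolding C'_def by (intro mult_right_mono; simp)+
      then have "\<forall>x'\<in>insert b B. \<bar>(c(b := k)) x'\<bar> \<le> C' * norm x"
        using kx sC c(2) by (auto intro: order_trans)
      ultimately show ?thesis by blast
    qed
    moreover have "C' \<ge> 0" using \<open>\<delta> > 0\<close> by (simp add: C'_def le_max_iff_disj)
    ultimately show ?thesis by blast
  qed
qed

lemma closed_span_finite:
  fixes B :: "'a::real_normed_vector set"
  assumes "finite B"
  shows "closed (span B)"
proof -
  obtain C where "C \<ge> 0"
    "\<forall>x\<in>span B. \<exists>c. x = (\<Sum>b\<in>B. c b *\<^sub>R b) \<and> (\<forall>b\<in>B. \<bar>c b\<bar> \<le> C * norm x)"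
    using finite_span_coefficients_bounded[OF assms] by blast
  then show ?thesis
    using closed_span_if_coefficients_bounded[OF assms] by simp
qed

lemma compact_cball_finite_span:
  fixes B :: "'a::real_normed_vector set"
  assumes "finite B" and "span B = UNIV"
  shows "compact (cball (0::'a) r)"
proof -
  obtain C where C: "C \<ge> 0"
    "\<And>x. \<exists>c. x = (\<Sum>b\<in>B. c b *\<^sub>R b) \<and> (\<forall>b\<in>B. \<bar>c b\<bar> \<le> C * norm x)"
    using finite_span_coefficients_bounded[OF assms(1)] assms(2) by auto
  let ?S = "{(\<Sum>b\<in>B. c b *\<^sub>R b) | c. \<forall>b\<in>B. \<bar>c b\<bar> \<le> C * r}"
  have "cball 0 r \<subseteq> ?S"
  proof
    fix x :: 'a assume "x \<in> cball 0 r"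
    then have "C * norm x \<le> C * r" using C(1) by (intro mult_left_mono) auto
    moreover obtain c where "x = (\<Sum>b\<in>B. c b *\<^sub>R b)" "\<forall>b\<in>B. \<bar>c b\<bar> \<le> C * norm x"
      using C(2) by blast
    ultimately show "x \<in> ?S" by (blast intro: order_trans)
  qed
  then show ?thesis
    using compact_Int_closed[OF compact_bounded_combinations[OF assms(1), of "C * r"] closed_cball, of 0 r]
    by (simp add: Int_absorb1)
qed

lemma linear_finite_span_imp_bounded_linear:
  fixes B :: "'a::real_normed_vector set" and f :: "'a::real_normed_vector \<Rightarrow> 'b::real_normed_vector"
  assumes "finite B" and "span B = UNIV" and "linear f"
  shows "bounded_linear f"
proof -
  obtain C where C: "C \<ge> 0"
    "\<And>x::'a. \<exists>c. x = (\<Sum>b\<in>B. c b *\<^sub>R b) \<and> (\<forall>b\<in>B. \<bar>c b\<bar> \<le> C * norm x)"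
    using finite_span_coefficients_bounded[OF assms(1)] assms(2) by auto
  have "norm (f x) \<le> norm x * (C * (\<Sum>b\<in>B. norm (f b)))" for x
  proof -
    obtain c where c: "x = (\<Sum>b\<in>B. c b *\<^sub>R b)" "\<forall>b\<in>B. \<bar>c b\<bar> \<le> C * norm x" using C(2) by blast
    have "f x = (\<Sum>b\<in>B. c b *\<^sub>R f b)"
      using c(1) assms(3) by (simp add: linear_sum linear_cmul)
    also have "norm \<dots> \<le> (\<Sum>b\<in>B. \<bar>c b\<bar> * norm (f b))"
      by (rule order_trans[OF norm_sum]) simp
    also have "\<dots> \<le> (\<Sum>b\<in>B. C * norm x * norm (f b))"
      using c(2) by (intro sum_mono mult_right_mono) auto
    finally show ?thesis by (simp add: sum_distrib_left mult_ac)
  qed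
  then show ?thesis
    using assms(3) by (intro bounded_linear.intro bounded_linear_axioms.intro) auto
qed

text \<open>
  Riesz: centres of a finite cover of the unit ball by balls of radius \<open>1/2\<close> already span the space.
  Otherwise, choose \<open>x\<close> outside their closed span, at distance \<open>\<delta>\<close>, and \<open>v\<close> in the span less than
  \<open>2\<delta>\<close> away from \<open>x\<close>. The normalised difference of \<open>x\<close> and \<open>v\<close> is a unit vector at distance more
  than \<open>1/2\<close> from the span, hence from all centres.
\<close>

lemma compact_cball_imp_finite_span:
  assumes "compact (cball (0::'a::real_normed_vector) 1)"
  obtains B :: "'a::real_normed_vector set" where "finite B" and "span B = UNIV"
proof -
  obtain B :: "'a set" where B: "finite B" "cball 0 1 \<subseteq> (\<Union>b\<in>B. ball b (1/2))"
    using assms[unfolded compact_eq_totally_bounded, THEN conjunct2, rule_format, of "1/2"] by auto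
  have "span B = UNIV"
  proof (rule ccontr)
    assume "span B \<noteq> UNIV"
    then obtain x where x: "x \<notin> span B" by blast
    define \<delta> where "\<delta> = infdist x (span B)"
    have "\<delta> > 0"
      using x closed_span_finite[OF B(1)] in_closed_iff_infdist_zero[of "span B" x] span_zero[of B]
      unfolding \<delta>_def by (metis empty_iff infdist_nonneg less_le)
    then obtain v where v: "v \<in> span B" "dist x v < 2 * \<delta>"
      using cINF_less_iff[of "span B" "dist x" "2 * \<delta>"] span_zero[of B]
      unfolding \<delta>_def infdist_def by (auto simp: bdd_below_def intro: zero_le_dist split: if_splits)
    define d where "d = norm (x - v)"
    have "d > 0" using v x by (auto simp: d_def)
    have "(1 / d) *\<^sub>R (x - v) \<in> cball 0 1" using \<open>d > 0\<close> by (simp add: d_def)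
    then have "(1 / d) *\<^sub>R (x - v) \<in> (\<Union>b\<in>B. ball b (1/2))" using B by blast
    then obtain b where b: "b \<in> B" "norm (b - (1 / d) *\<^sub>R (x - v)) < 1 / 2"
      by (auto simp: dist_norm)
    have "v + d *\<^sub>R b \<in> span B" using v b by (metis span_add span_scale span_base)
    then have "\<delta> \<le> dist x (v + d *\<^sub>R b)" unfolding \<delta>_def by (rule infdist_le)
    also have "dist x (v + d *\<^sub>R b) = norm (d *\<^sub>R (b - (1 / d) *\<^sub>R (x - v)))"
      using \<open>d > 0\<close> by (simp add: dist_norm norm_minus_commute algebra_simps)
    also have "\<dots> = d * norm (b - (1 / d) *\<^sub>R (x - v))" using \<open>d > 0\<close> by simp
    also have "\<dots> < d * (1 / 2)" using b \<open>d > 0\<close> by (intro mult_strict_left_mono)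
    also have "\<dots> < \<delta>" using v by (simp add: d_def dist_norm)
    finally have "\<delta> < \<delta>" .
    then show False by simp
  qed
  then show thesis using that B by blast
qed

section \<open>Decay of resolvents along the positive real axis\<close>

text \<open>
  The real numbers \<open>l\<close> from some point on lie in the resolvent set, with resolvents of norm \<open>O(1/l)\<close>.
  Only real scalars occur, so that the notion is preserved by similarities that are merely real-linear.
\<close>

definition resolvent_decay :: "'a::real_normed_vector set \<Rightarrow> ('a \<Rightarrow> 'a) \<Rightarrow> bool" where
  "resolvent_decay D T \<longleftrightarrow>
     (\<exists>C>0. \<exists>l0>0. \<forall>l\<ge>l0.
        (\<forall>w. \<exists>u\<in>D. l *\<^sub>R u - T u = w) \<and>
        (\<forall>u\<in>D. l * norm u \<le> C * norm (l *\<^sub>R u - T u)))"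

lemma resolvent_decayI:
  assumes "C > 0" "l0 > 0" "\<And>l w. l \<ge> l0 \<Longrightarrow> \<exists>u\<in>D. l *\<^sub>R u - T u = w"
    "\<And>l u. l \<ge> l0 \<Longrightarrow> u \<in> D \<Longrightarrow> l * norm u \<le> C * norm (l *\<^sub>R u - T u)"
  shows "resolvent_decay D T"
  using assms unfolding resolvent_decay_def by blast

lemma has_vector_derivative_at_iff_quotient:
  fixes f :: "real \<Rightarrow> 'a::real_normed_vector"
  shows "(f has_vector_derivative y) (at t) \<longleftrightarrow> ((\<lambda>h. (f (t + h) - f t) /\<^sub>R h) \<longlongrightarrow> y) (at 0)"
proof -
  have eq: "norm (f (t + h) - f t - h *\<^sub>R y) / \<bar>h\<bar> = norm ((f (t + h) - f t) /\<^sub>R h - y)" if "h \<noteq> 0" for h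
  proof -
    have "(f (t + h) - f t) /\<^sub>R h - y = (f (t + h) - f t - h *\<^sub>R y) /\<^sub>R h"
      using that by (simp add: scaleR_diff_right)
    then have "norm ((f (t + h) - f t) /\<^sub>R h - y) = norm (f (t + h) - f t - h *\<^sub>R y) / \<bar>h\<bar>"
      by (simp add: divide_inverse mult.commute)
    then show ?thesis by simp
  qed
  have "(f has_vector_derivative y) (at t) \<longleftrightarrow>
      ((\<lambda>h. norm (f (t + h) - f t - h *\<^sub>R y) / norm h) \<longlongrightarrow> 0) (at 0)"
    by (simp add: has_vector_derivative_def has_derivative_at bounded_linear_scaleR_left)
  also have "\<dots> \<longleftrightarrow> ((\<lambda>h. norm ((f (t + h) - f t) /\<^sub>R h - y)) \<longlongrightarrow> 0) (at 0)"
    by (intro filterlim_cong refl) (auto simp: eventually_at_filter eq intro!: always_eventually)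
  also have "\<dots> \<longleftrightarrow> ((\<lambda>h. (f (t + h) - f t) /\<^sub>R h) \<longlongrightarrow> y) (at 0)"
    by (simp add: tendsto_norm_zero_iff Lim_null[of _ y, symmetric])
  finally show ?thesis .
qed

lemma linear_operator_real_iff:
  fixes T :: "'a::real_vector \<Rightarrow> 'b::real_vector"
  shows "linear_operator scaleR scaleR D T \<longleftrightarrow>
     subspace D \<and> (\<forall>u\<in>D. \<forall>v\<in>D. T (u + v) = T u + T v) \<and> (\<forall>c. \<forall>u\<in>D. T (c *\<^sub>R u) = c *\<^sub>R T u)"
  by (simp add: linear_operator_def subspace_raw_def)

lemma linear_operator_real_diff:
  fixes T :: "'a::real_vector \<Rightarrow> 'b::real_vector"
  assumes "linear_operator scaleR scaleR D T" "u \<in> D" "v \<in> D"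
  shows "u - v \<in> D" "T (u - v) = T u - T v"
proof -
  note lin = linear_operator_real_iff[THEN iffD1, OF assms(1)]
  show "u - v \<in> D" using lin assms by (blast intro: subspace_diff)
  have "- v \<in> D" using lin assms by (blast intro: subspace_neg)
  moreover have "T (- v) = - T v" using lin assms(3) by (metis scaleR_minus1_left)
  ultimately show "T (u - v) = T u - T v"
    using lin assms by (metis diff_conv_add_uminus)
qed

text \<open>
  The Laplace transform truncated to the interval \<open>[0, 1]\<close> suffices:
  with \<open>V x = \<integral>\<^sub>0\<^sup>1 e\<^bsup>-lt\<^esup> S(t) x dt\<close> the range of \<open>V\<close> lies in \<open>D\<close> and
  \<open>(l - T) V x = x - e\<^bsup>-l\<^esup> S(1) x\<close> for all \<open>x\<close>, while \<open>V (l - T) x = x - e\<^bsup>-l\<^esup> S(1) x\<close> for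
  \<open>x \<in> D\<close>. If \<open>M\<close> bounds \<open>S(t)\<close> for \<open>0 \<le> t \<le> 1\<close>, then \<open>V\<close> has norm at most \<open>M / l\<close>, and for
  \<open>l \<ge> 2M\<close> the perturbation \<open>e\<^bsup>-l\<^esup> S(1)\<close> of the identity is a contraction with constant \<open>1/2\<close>. The
  first identity then yields surjectivity and the second the estimate, without any information on the
  growth of \<open>S(t)\<close> for large \<open>t\<close>.
\<close>

lemma generator_linear_and_resolvent_decay:
  fixes D :: "'a::banach set"
  assumes "generates_group s D T"
  shows "linear_operator scaleR scaleR D T" and "resolvent_decay D T"
proof -
  obtain S where scg: "strongly_continuous_group s S"
    and gen: "\<And>x y. (x \<in> D \<and> T x = y) \<longleftrightarrow> ((\<lambda>h. (S h x - x) /\<^sub>R h) \<longlongrightarrow> y) (at 0)"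
    using assms unfolding generates_group_def by blast
  have bl: "bounded_linear (S t)" for t
    using scg by (simp add: strongly_continuous_group_def bounded_operator_def)
  have S0: "S 0 x = x" for x using scg by (simp add: strongly_continuous_group_def)
  have S_add: "S (t + r) x = S t (S r x)" for t r x
    using scg by (simp add: strongly_continuous_group_def)
  have cont: "continuous_on A (\<lambda>t. S t x)" for A x
    using scg unfolding strongly_continuous_group_def by (meson continuous_on_subset subset_UNIV)
  have gen': "(x \<in> D \<and> T x = y) \<longleftrightarrow> ((\<lambda>t. S t x) has_vector_derivative y) (at 0)" for x y
    using gen by (simp add: has_vector_derivative_at_iff_quotient S0)
  have der0: "((\<lambda>t. S t x) has_vector_derivative T x) (at 0)" if "x \<in> D" for x
    using gen' that by blast
  show "linear_operator scaleR scaleR D T"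
    unfolding linear_operator_real_iff
  proof (intro conjI ballI allI)
    have add: "u + v \<in> D \<and> T (u + v) = T u + T v" if "u \<in> D" "v \<in> D" for u v
      using has_vector_derivative_add[OF der0[OF that(1)] der0[OF that(2)]] gen'[of "u + v"] bl
      by (simp add: linear_simps)
    have scale: "c *\<^sub>R u \<in> D \<and> T (c *\<^sub>R u) = c *\<^sub>R T u" if "u \<in> D" for u c
      using bounded_linear.has_vector_derivative[OF bounded_linear_scaleR_right[of c] der0[OF that]]
        gen'[of "c *\<^sub>R u"] bl
      by (simp add: linear_simps)
    have "0 \<in> D" using gen'[of 0 0] bl by (simp add: linear_simps)
    then show "subspace D" using add scale by (simp add: subspace_def)
    show "T (u + v) = T u + T v" if "u \<in> D" "v \<in> D" for u v using add that by blast
    show "T (c *\<^sub>R u) = c *\<^sub>R T u" if "u \<in> D" for u c using scale that by blast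
  qed
  have der: "((\<lambda>t. S t x) has_vector_derivative S t (T x)) (at t)" if "x \<in> D" for x t
  proof -
    have "((\<lambda>h. S t ((S h x - x) /\<^sub>R h)) \<longlongrightarrow> S t (T x)) (at 0)"
      using gen that by (intro bounded_linear.tendsto[OF bl]) blast
    then show ?thesis
      unfolding has_vector_derivative_at_iff_quotient using bl by (simp add: S_add linear_simps)
  qed
  have "\<exists>M>0. \<forall>t\<in>{0..1}. \<forall>x. norm (S t x) \<le> M * norm x"
    using bl by (intro uniform_boundedness_principle compact_imp_bounded compact_continuous_image
        cont compact_Icc)
  then obtain M where M: "M > 0" "\<And>t x. t \<in> {0..1} \<Longrightarrow> norm (S t x) \<le> M * norm x" by blast
  define \<psi> where "\<psi> l w t = exp (- l * t) *\<^sub>R S t w" for l w t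
  define V where "V l w = integral {0..1} (\<psi> l w)" for l w
  have cont_\<psi>: "continuous_on A (\<psi> l w)" for A l w
    unfolding \<psi>_def by (intro continuous_intros cont)
  have \<psi>_small: "norm (\<psi> l w 1) \<le> 1 / 2 * norm w" if "l \<ge> 2 * M" for l w
  proof -
    have "2 * M \<le> exp l" using that exp_ge_add_one_self[of l] by linarith
    then have "exp (- l) * M \<le> 1 / 2" by (simp add: exp_minus field_simps)
    then have "exp (- l) * M * norm w \<le> 1 / 2 * norm w" by (rule mult_right_mono) simp
    moreover have "norm (\<psi> l w 1) \<le> exp (- l) * (M * norm w)"
      unfolding \<psi>_def using M(2)[of 1 w] by simp
    ultimately show ?thesis by (simp add: mult.assoc)
  qed
  have V_bound: "l * norm (V l w) \<le> M * norm w" if "l > 0" for l w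
  proof -
    let ?g = "\<lambda>t. M * norm w * exp (- l * t)"
    have g: "(?g has_integral (- (M * norm w * exp (- l * 1) / l) - - (M * norm w * exp (- l * 0) / l))) {0..1}"
      using that by (intro fundamental_theorem_of_calculus)
        (auto intro!: derivative_eq_intros simp: has_real_derivative_iff_has_vector_derivative[symmetric])
    have "norm (V l w) \<le> integral {0..1} ?g"
      unfolding V_def
    proof (rule integral_norm_bound_integral)
      show "\<psi> l w integrable_on {0..1}" by (intro integrable_continuous_real cont_\<psi>)
      show "?g integrable_on {0..1}" using g by blast
      show "norm (\<psi> l w t) \<le> ?g t" if "t \<in> {0..1}" for t
        using mult_left_mono[OF M(2)[OF that, of w], of "exp (- l * t)"] by (simp add: \<psi>_def mult_ac)
    qed
    also have "\<dots> = M * norm w * (1 - exp (- l)) / l"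
      using integral_unique[OF g] by (simp add: algebra_simps diff_divide_distrib)
    also have "\<dots> \<le> M * norm w / l"
      using M(1) that by (intro divide_right_mono mult_left_le) auto
    finally show ?thesis using that by (simp add: field_simps)
  qed
  have V_left: "V l (l *\<^sub>R x - T x) = x - \<psi> l x 1" if "x \<in> D" for l x
  proof -
    have "(\<psi> l x has_vector_derivative - \<psi> l (l *\<^sub>R x - T x) t) (at t)" for t
    proof -
      have "((\<lambda>t. exp (- l * t)) has_real_derivative - l * exp (- l * t)) (at t)"
        by (auto intro!: derivative_eq_intros)
      from has_vector_derivative_scaleR[OF this der[OF that, of t]]
      show ?thesis using bl by (simp add: \<psi>_def[abs_def] linear_simps scaleR_diff_right mult.commute)
    qed
    then have "((\<lambda>t. - \<psi> l (l *\<^sub>R x - T x) t) has_integral \<psi> l x 1 - \<psi> l x 0) {0..1}"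
      by (intro fundamental_theorem_of_calculus) (auto intro: has_vector_derivative_at_within)
    from has_integral_neg[OF this] have "(\<psi> l (l *\<^sub>R x - T x) has_integral \<psi> l x 0 - \<psi> l x 1) {0..1}"
      by simp
    then show ?thesis
      unfolding V_def by (simp add: \<psi>_def S0 integral_unique)
  qed
  have V_right: "V l w \<in> D \<and> T (V l w) = l *\<^sub>R V l w - (w - \<psi> l w 1)" for l w
  proof -
    \<comment> \<open>An antiderivative that starts at a point to the left of \<open>0\<close>, so that \<open>\<Psi>\<close> is differentiable on both sides of \<open>0\<close> and of \<open>1\<close>.\<close>
    define \<Psi> where "\<Psi> x = integral {-1..x} (\<psi> l w)" for x
    have \<Psi>: "(\<Psi> has_vector_derivative \<psi> l w x) (at x)" if "-1 < x" "x < 3" for x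
      using integral_has_vector_derivative[OF cont_\<psi>, where x=x and a="-1" and b=3 and l1=l and w1=w] that
      unfolding \<Psi>_def by (simp add: at_within_Icc_at)
    have shifted: "((\<lambda>t. \<psi> l w (t + h)) has_integral \<Psi> (1 + h) - \<Psi> (0 + h)) {0..1}"
      if "-1 < h" "h < 1" for h
    proof (intro fundamental_theorem_of_calculus)
      fix t :: real assume t: "t \<in> {0..1}"
      have "((\<lambda>t. t + h) has_vector_derivative 1) (at t)"
        by (auto intro!: derivative_eq_intros)
      from vector_diff_chain_at[OF this \<Psi>[of "t + h"]] t that
      show "((\<lambda>t. \<Psi> (t + h)) has_vector_derivative \<psi> l w (t + h)) (at t within {0..1})"
        by (simp add: o_def has_vector_derivative_at_within)
    qed simp
    \<comment> \<open>Moving \<open>S h\<close> under the integral shifts the window of integration by \<open>h\<close>.\<close>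
    have S_V: "S h (V l w) = exp (l * h) *\<^sub>R (\<Psi> (1 + h) - \<Psi> h)" if "-1 < h" "h < 1" for h
    proof -
      have "S h (V l w) = integral {0..1} (S h \<circ> \<psi> l w)"
        unfolding V_def
        by (intro integral_linear[symmetric] integrable_continuous_real cont_\<psi> bl)
      also have "S h \<circ> \<psi> l w = (\<lambda>t. exp (l * h) *\<^sub>R \<psi> l w (t + h))"
        using bl by (auto simp: \<psi>_def linear_simps S_add[symmetric] add.commute algebra_simps exp_add[symmetric])
      also have "integral {0..1} \<dots> = exp (l * h) *\<^sub>R (\<Psi> (1 + h) - \<Psi> h)"
        using integral_unique[OF shifted[OF that]] by simp
      finally show ?thesis .
    qed
    have V: "V l w = \<Psi> 1 - \<Psi> 0" using S_V[of 0] by (simp add: S0)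
    have "((\<lambda>h. \<Psi> (1 + h) - \<Psi> h) has_vector_derivative \<psi> l w 1 - \<psi> l w 0) (at 0)"
    proof (intro has_vector_derivative_diff)
      have "((\<lambda>h. 1 + h) has_vector_derivative 1) (at (0::real))"
        by (auto intro!: derivative_eq_intros)
      from vector_diff_chain_at[OF this \<Psi>[of "1 + 0"]]
      show "((\<lambda>h. \<Psi> (1 + h)) has_vector_derivative \<psi> l w 1) (at 0)" by (simp add: o_def)
      show "(\<Psi> has_vector_derivative \<psi> l w 0) (at 0)" by (rule \<Psi>) auto
    qed
    moreover have "((\<lambda>h. exp (l * h)) has_real_derivative l) (at 0)"
      by (auto intro!: derivative_eq_intros)
    ultimately have "((\<lambda>h. exp (l * h) *\<^sub>R (\<Psi> (1 + h) - \<Psi> h)) has_vector_derivative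
        exp (l * 0) *\<^sub>R (\<psi> l w 1 - \<psi> l w 0) + l *\<^sub>R (\<Psi> (1 + 0) - \<Psi> 0)) (at 0)"
      by (intro has_vector_derivative_scaleR)
    then have "((\<lambda>h. S h (V l w)) has_vector_derivative
        exp (l * 0) *\<^sub>R (\<psi> l w 1 - \<psi> l w 0) + l *\<^sub>R (\<Psi> (1 + 0) - \<Psi> 0)) (at 0)"
      by (rule has_vector_derivative_transform_within_open[where S = "{-1<..<1}"]) (auto simp: S_V)
    then show ?thesis
      unfolding gen' by (simp add: V \<psi>_def S0 algebra_simps)
  qed
  show "resolvent_decay D T"
  proof (rule resolvent_decayI[of "2 * M" "2 * M"])
    fix l w assume l: "2 * M \<le> l"
    let ?\<Phi> = "\<lambda>z. w + \<psi> l z 1"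
    have "dist (?\<Phi> x) (?\<Phi> y) \<le> 1 / 2 * dist x y" for x y
    proof -
      have "?\<Phi> x - ?\<Phi> y = \<psi> l (x - y) 1"
        using bl by (simp add: \<psi>_def linear_simps scaleR_diff_right)
      then show ?thesis using \<psi>_small[OF l, of "x - y"] by (simp add: dist_norm)
    qed
    then obtain z where "w + \<psi> l z 1 = z" using banach_fix_type[of "1/2" ?\<Phi>] by auto
    then have "l *\<^sub>R V l z - T (V l z) = w" using V_right[of l z] by (simp add: diff_eq_eq)
    then show "\<exists>u\<in>D. l *\<^sub>R u - T u = w" using V_right by blast
  next
    fix l u assume l: "2 * M \<le> l" and u: "u \<in> D"
    have "l > 0" using l M(1) by linarith
    have "norm u \<le> norm (V l (l *\<^sub>R u - T u)) + norm (\<psi> l u 1)"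
      unfolding V_left[OF u] by (metis diff_add_cancel norm_triangle_ineq)
    with \<psi>_small[OF l, of u] have "norm u \<le> 2 * norm (V l (l *\<^sub>R u - T u))" by simp
    then have "l * norm u \<le> 2 * (l * norm (V l (l *\<^sub>R u - T u)))"
      using \<open>l > 0\<close> by (simp add: mult.left_commute[of l])
    also have "\<dots> \<le> 2 * M * norm (l *\<^sub>R u - T u)"
      using V_bound[OF \<open>l > 0\<close>] by simp
    finally show "l * norm u \<le> 2 * M * norm (l *\<^sub>R u - T u)" .
  qed (use M in auto)
qed

text \<open>
  For \<open>l \<ge> 2C norm B\<close> the operator \<open>(l - T)\<inverse> B\<close> has norm at most \<open>1/2\<close>, so that the equation
  \<open>u = (l - T)\<inverse> (w + B u)\<close>, which is \<open>(l - T - B) u = w\<close>, has a solution by Banach's fixed point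
  theorem.
\<close>

lemma resolvent_decay_bounded_perturbation:
  fixes D :: "'a::banach set"
  assumes "resolvent_decay D T" and "linear_operator scaleR scaleR D T" and "bounded_linear B"
  shows "resolvent_decay D (\<lambda>u. T u + B u)"
proof -
  obtain C l0 where C: "C > 0" "l0 > 0" "\<And>l w. l \<ge> l0 \<Longrightarrow> \<exists>u\<in>D. l *\<^sub>R u - T u = w"
    "\<And>l u. l \<ge> l0 \<Longrightarrow> u \<in> D \<Longrightarrow> l * norm u \<le> C * norm (l *\<^sub>R u - T u)"
    using assms(1) unfolding resolvent_decay_def by blast
  obtain K where K: "K > 0" "\<And>x. norm (B x) \<le> norm x * K"
    using bounded_linear.pos_bounded[OF assms(3)] by blast
  show ?thesis
  proof (rule resolvent_decayI[of "2 * C" "max l0 (2 * C * K)"])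
    have CB: "C * norm (B x) \<le> 1 / 2 * (l * norm x)" if l: "max l0 (2 * C * K) \<le> l" for l x
    proof -
      have "C * norm (B x) \<le> C * (norm x * K)" using K(2)[of x] C(1) by (intro mult_left_mono) auto
      also have "\<dots> = 1 / 2 * (2 * (C * K) * norm x)" by simp
      also have "\<dots> \<le> 1 / 2 * (l * norm x)" using l by (intro mult_left_mono mult_right_mono) auto
      finally show ?thesis .
    qed
    {
      fix l w assume l_ge: "max l0 (2 * C * K) \<le> l"
      then have l: "l \<ge> l0" "l > 0" using C by auto
      obtain G where G: "\<And>w. G w \<in> D" "\<And>w. l *\<^sub>R G w - T (G w) = w" using C(3)[OF l(1)] by metis
      let ?\<Phi> = "\<lambda>v. G (w + B v)"
      have "dist (?\<Phi> x) (?\<Phi> y) \<le> 1 / 2 * dist x y" for x y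
      proof -
        let ?d = "?\<Phi> x - ?\<Phi> y"
        note d = linear_operator_real_diff[OF assms(2) G(1) G(1), of "w + B x" "w + B y"]
        have "l *\<^sub>R ?d - T ?d = (l *\<^sub>R ?\<Phi> x - T (?\<Phi> x)) - (l *\<^sub>R ?\<Phi> y - T (?\<Phi> y))"
          unfolding d(2) by (simp add: scaleR_diff_right)
        also have "\<dots> = B (x - y)"
          unfolding G(2) using assms(3) by (simp add: linear_simps)
        finally have "l * norm ?d \<le> C * norm (B (x - y))" using C(4)[OF l(1) d(1)] by simp
        also have "\<dots> \<le> l * (1 / 2 * norm (x - y))" using CB[OF l_ge, of "x - y"] by simp
        finally show ?thesis using l(2) by (simp add: dist_norm)
      qed
      then obtain u where "G (w + B u) = u" using banach_fix_type[of "1/2" ?\<Phi>] by auto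
      then have "u \<in> D" "l *\<^sub>R u - T u = w + B u" using G by metis+
      then show "\<exists>u\<in>D. l *\<^sub>R u - (T u + B u) = w" by (intro bexI[of _ u]) (auto simp: algebra_simps)
    }
    fix l u assume l: "max l0 (2 * C * K) \<le> l" and u: "u \<in> D"
    have "norm (l *\<^sub>R u - T u) \<le> norm (l *\<^sub>R u - (T u + B u)) + norm (B u)"
      using norm_triangle_ineq[of "l *\<^sub>R u - (T u + B u)" "B u"] by (simp add: algebra_simps)
    then have "C * norm (l *\<^sub>R u - T u) \<le> C * norm (l *\<^sub>R u - (T u + B u)) + C * norm (B u)"
      using C(1) by (metis distrib_left mult_le_cancel_left_pos)
    then show "l * norm u \<le> 2 * C * norm (l *\<^sub>R u - (T u + B u))"
      using C(4)[OF _ u, of l] CB[OF l, of u] l by simp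
  qed (use C in auto)
qed

lemma resolvent_decay_extend_by_zero:
  fixes D :: "'a::real_normed_vector set"
  assumes "resolvent_decay D T"
  shows "resolvent_decay (D \<times> (UNIV :: 'b::real_normed_vector set)) (\<lambda>(u, x). (T u, 0))"
proof -
  obtain C l0 where C: "C > 0" "l0 > 0" "\<And>l w. l \<ge> l0 \<Longrightarrow> \<exists>u\<in>D. l *\<^sub>R u - T u = w"
    "\<And>l u. l \<ge> l0 \<Longrightarrow> u \<in> D \<Longrightarrow> l * norm u \<le> C * norm (l *\<^sub>R u - T u)"
    using assms(1) unfolding resolvent_decay_def by blast
  show ?thesis
  proof (rule resolvent_decayI[of "C + 1" "l0"])
    fix l and w :: "'a \<times> 'b" assume l: "l0 \<le> l"
    obtain u where "u \<in> D" "l *\<^sub>R u - T u = fst w" using C(3)[OF l] by blast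
    then show "\<exists>p\<in>D \<times> UNIV. l *\<^sub>R p - (case p of (u, x) \<Rightarrow> (T u, 0)) = w"
      using l C(2) by (intro bexI[of _ "(u, (1 / l) *\<^sub>R snd w)"]) (auto simp: prod_eq_iff)
  next
    fix l and p :: "'a \<times> 'b" assume l: "l0 \<le> l" and "p \<in> D \<times> UNIV"
    then obtain u x where p: "p = (u, x)" "u \<in> D" by auto
    let ?w = "(l *\<^sub>R u - T u, l *\<^sub>R x)"
    have "l * norm p \<le> l * (norm u + norm x)"
      unfolding p using l C(2) by (intro mult_left_mono norm_Pair_le) auto
    also have "\<dots> \<le> C * norm (fst ?w) + norm (snd ?w)"
      using C(4)[OF l p(2)] l C(2) by (simp add: algebra_simps)
    also have "\<dots> \<le> C * norm ?w + norm ?w"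
      using C(1) norm_fst_le[of "fst ?w" "snd ?w"] norm_snd_le[of "snd ?w" "fst ?w"]
      by (intro add_mono mult_left_mono) simp_all
    finally show "l * norm p \<le> (C + 1) * norm (l *\<^sub>R p - (case p of (u, x) \<Rightarrow> (T u, 0)))"
      by (simp add: p algebra_simps)
  qed (use C in auto)
qed

lemma linear_operator_real_extend_by_zero:
  assumes "linear_operator scaleR scaleR D T"
  shows "linear_operator scaleR scaleR (D \<times> UNIV) (\<lambda>(u, x). (T u, 0))"
  using assms by (auto simp: linear_operator_real_iff subspace_def zero_prod_def)

lemma resolvent_decay_similarity:
  assumes "resolvent_decay D T" and U: "bounded_linear U" and V: "bounded_linear V"
    and VU: "\<And>p. V (U p) = p" and UV: "\<And>q. U (V q) = q"
    and dom: "\<And>p. p \<in> D' \<longleftrightarrow> U p \<in> D" and op: "\<And>p. p \<in> D' \<Longrightarrow> T' p = V (T (U p))"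
  shows "resolvent_decay D' T'"
proof -
  obtain C l0 where C: "C > 0" "l0 > 0" "\<And>l w. l \<ge> l0 \<Longrightarrow> \<exists>u\<in>D. l *\<^sub>R u - T u = w"
    "\<And>l u. l \<ge> l0 \<Longrightarrow> u \<in> D \<Longrightarrow> l * norm u \<le> C * norm (l *\<^sub>R u - T u)"
    using assms(1) unfolding resolvent_decay_def by blast
  obtain a where a: "a > 0" "\<And>x. norm (U x) \<le> norm x * a"
    using bounded_linear.pos_bounded[OF U] by blast
  obtain b where b: "b > 0" "\<And>x. norm (V x) \<le> norm x * b"
    using bounded_linear.pos_bounded[OF V] by blast
  have conj: "U (l *\<^sub>R p - T' p) = l *\<^sub>R U p - T (U p)" if "p \<in> D'" for l p
    using U op[OF that] UV by (simp add: linear_simps)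
  show ?thesis
  proof (rule resolvent_decayI[of "b * C * a" "l0"])
    fix l w assume l: "l0 \<le> l"
    obtain q where q: "q \<in> D" "l *\<^sub>R q - T q = U w" using C(3)[OF l] by blast
    have "V q \<in> D'" using q dom UV by simp
    moreover from conj[OF this] have "U (l *\<^sub>R V q - T' (V q)) = U w" using q UV by simp
    then have "l *\<^sub>R V q - T' (V q) = w" by (metis VU)
    ultimately show "\<exists>p\<in>D'. l *\<^sub>R p - T' p = w" by blast
  next
    fix l p assume l: "l0 \<le> l" and p: "p \<in> D'"
    have "l * norm p = l * norm (V (U p))" by (simp add: VU)
    also have "\<dots> \<le> l * (norm (U p) * b)" using b(2)[of "U p"] l C(2) by (intro mult_left_mono) auto
    also have "\<dots> = b * (l * norm (U p))" by simp
    also have "\<dots> \<le> b * (C * norm (l *\<^sub>R U p - T (U p)))"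
      using b(1) C(4)[OF l] p dom by (intro mult_left_mono) auto
    also have "\<dots> \<le> b * (C * (norm (l *\<^sub>R p - T' p) * a))"
      using a(2)[of "l *\<^sub>R p - T' p"] b(1) C(1) unfolding conj[OF p] by (intro mult_left_mono) auto
    finally show "l * norm p \<le> b * C * a * norm (l *\<^sub>R p - T' p)" by (simp add: mult_ac)
  qed (use a b C in auto)
qed

section \<open>Banach spaces over the scalar field\<close>

lemma banach_space_over_simps:
  assumes "banach_space_over s"
  shows "s (of_real r) x = r *\<^sub>R x" "norm (s c x) = norm c * norm x"
    "s c (x + y) = s c x + s c y" "s (a + b) x = s a x + s b x" "s a (s b x) = s (a * b) x"
    "s c 0 = 0" "s c (- x) = - s c x" "s c (x - y) = s c x - s c y" "s 1 x = x"
proof -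
  interpret vector_space s using assms by (simp add: banach_space_over_def)
  show "s (of_real r) x = r *\<^sub>R x" "norm (s c x) = norm c * norm x"
    using assms by (simp_all add: banach_space_over_def)
  show "s c (x + y) = s c x + s c y" "s (a + b) x = s a x + s b x" "s a (s b x) = s (a * b) x"
    "s c 0 = 0" "s c (- x) = - s c x" "s c (x - y) = s c x - s c y" "s 1 x = x"
    by (simp_all add: scale_right_distrib scale_left_distrib scale_right_diff_distrib)
qed

lemma banach_space_over_module: "banach_space_over s \<Longrightarrow> module s"
  by (simp add: banach_space_over_def module_iff_vector_space)

lemma scale2_Pair:
  assumes "banach_space_over s1" "banach_space_over s2"
  shows "scale2 s1 s2 c (x, y) = (s1 c x, s2 c y)"
proof -
  interpret module_prod s1 s2
    using assms[THEN banach_space_over_module] by (simp add: module_prod_def module_pair_def)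
  show ?thesis by (simp add: scale_prod)
qed

lemma banach_space_over_scale2:
  assumes "banach_space_over s1" "banach_space_over s2"
  shows "banach_space_over (scale2 s1 s2)"
  unfolding banach_space_over_def
proof (intro conjI allI)
  note simps = scale2_Pair[OF assms] banach_space_over_simps[OF assms(1)] banach_space_over_simps[OF assms(2)]
  show "vector_space (scale2 s1 s2)"
    by unfold_locales (auto simp: simps)
  show "scale2 s1 s2 (of_real r) p = r *\<^sub>R p" for r p
    by (cases p) (simp add: simps)
  show "norm (scale2 s1 s2 c p) = norm c * norm p" for c p
    by (cases p) (simp add: simps norm_Pair power_mult_distrib distrib_left[symmetric] real_sqrt_mult)
qed

lemma linear_operator_iff:
  assumes "banach_space_over s1"
  shows "linear_operator s1 s2 D T \<longleftrightarrow>
    0 \<in> D \<and> (\<forall>u\<in>D. \<forall>v\<in>D. u + v \<in> D \<and> T (u + v) = T u + T v) \<and>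
    (\<forall>c. \<forall>u\<in>D. s1 c u \<in> D \<and> T (s1 c u) = s2 c (T u))"
  unfolding linear_operator_def module.subspace_def[OF banach_space_over_module[OF assms]] by blast

lemma linear_operator_imp_real:
  assumes "banach_space_over s1" "banach_space_over s2" "linear_operator s1 s2 D T"
  shows "linear_operator scaleR scaleR D T"
  unfolding linear_operator_real_iff subspace_def
  using assms(3)[unfolded linear_operator_iff[OF assms(1)]] banach_space_over_simps(1)[OF assms(1)]
    banach_space_over_simps(1)[OF assms(2)]
  by metis

text \<open>
  The scalar field is itself finite-dimensional over the reals, so multiplying a finite \<open>'k\<close>-spanning
  set by the elements of a real basis of \<open>'k\<close> gives a finite real spanning set.
\<close>

lemma finite_dimensional_iff_finite_real_span:
  fixes s :: "'k::{real_normed_field,euclidean_space} \<Rightarrow> 'a::banach \<Rightarrow> 'a"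
  assumes "banach_space_over s"
  shows "finite_dimensional s \<longleftrightarrow> (\<exists>B. finite B \<and> span B = (UNIV :: 'a set))"
proof
  note simps = banach_space_over_simps[OF assms]
  interpret M: module s using assms by (rule banach_space_over_module)
  {
    assume "finite_dimensional s"
    then obtain B where B: "finite B" "M.span B = UNIV" by (auto simp: finite_dimensional_def)
    define B' where "B' = (\<lambda>(e, b). s e b) ` (Basis \<times> B)"
    have generators: "s c b \<in> span B'" if "b \<in> B" for c b
    proof -
      have "s c b = s (\<Sum>e\<in>Basis. (c \<bullet> e) *\<^sub>R e) b" by (simp add: euclidean_representation)
      also have "\<dots> = (\<Sum>e\<in>Basis. s ((c \<bullet> e) *\<^sub>R e) b)" by (rule M.scale_sum_left)
      also have "\<dots> = (\<Sum>e\<in>Basis. (c \<bullet> e) *\<^sub>R s e b)"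
        by (simp only: scaleR_conv_of_real simps(5)[symmetric] simps(1))
      also have "\<dots> \<in> span B'"
        using that by (intro span_sum span_scale span_base) (auto simp: B'_def)
      finally show ?thesis .
    qed
    have scaled: "s c x \<in> span B'" if "x \<in> span B'" for c x
      using that
    proof (induction rule: span_induct_alt)
      case base
      then show ?case by (simp add: simps span_zero)
    next
      case (step r x y)
      obtain e b where "b \<in> B" "x = s e b" using step by (auto simp: B'_def)
      then have "s c x \<in> span B'" using generators[of b "c * e"] by (simp add: simps)
      moreover have "s c (r *\<^sub>R x) = r *\<^sub>R s c x"
        by (simp add: simps(5) flip: simps(1)) (simp add: mult.commute)
      ultimately show ?case using step by (simp add: simps span_add span_scale)
    qed
    have "M.span B \<subseteq> span B'"
    proof (rule M.span_minimal)
      show "B \<subseteq> span B'" using generators[of _ 1] by (auto simp: simps)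
      show "M.subspace (span B')" using scaled by (simp add: M.subspace_def span_zero span_add)
    qed
    then have "span B' = UNIV" using B by auto
    moreover have "finite B'" using B by (simp add: B'_def)
    ultimately show "\<exists>B. finite B \<and> span B = (UNIV :: 'a set)" by blast
  next
    assume "\<exists>B. finite B \<and> span B = (UNIV :: 'a set)"
    then obtain B where B: "finite B" "span B = (UNIV :: 'a set)" by blast
    have "span B \<subseteq> M.span B"
    proof (rule span_minimal)
      show "B \<subseteq> M.span B" by (rule M.span_superset)
      show "subspace (M.span B)"
        unfolding subspace_def using M.span_zero M.span_add M.span_scale simps(1) by metis
    qed
    then show "finite_dimensional s" using B by (auto simp: finite_dimensional_def)
  }
qed

section \<open>Compact embeddings and compact resolvents\<close>

text \<open>
  Homogeneity transfers the precompactness of the image of the unit ball to balls of any radius.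
\<close>

lemma precompact_bounded_part:
  fixes f :: "'a::real_vector \<Rightarrow> 'b::real_normed_vector"
  assumes "compact_map D nrm f"
    and hom: "\<And>c u. c > 0 \<Longrightarrow> u \<in> D \<Longrightarrow>
      c *\<^sub>R u \<in> D \<and> nrm (c *\<^sub>R u) = c * nrm u \<and> f (c *\<^sub>R u) = c *\<^sub>R f u"
  shows "\<exists>K. compact K \<and> f ` {u \<in> D. nrm u \<le> r} \<subseteq> K"
proof -
  define R where "R = max r 1"
  have R: "R > 0" "r \<le> R" by (auto simp: R_def)
  let ?K = "(\<lambda>x. R *\<^sub>R x) ` closure (f ` {u \<in> D. nrm u \<le> 1})"
  have "f u \<in> ?K" if u: "u \<in> D" "nrm u \<le> r" for u
  proof -
    have h: "(1 / R) *\<^sub>R u \<in> D" "nrm ((1 / R) *\<^sub>R u) = 1 / R * nrm u" "f ((1 / R) *\<^sub>R u) = (1 / R) *\<^sub>R f u"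
      using hom[OF _ u(1), of "1 / R"] R(1) by auto
    have "1 / R * nrm u \<le> 1" using u(2) R by (simp add: field_simps)
    then have "nrm ((1 / R) *\<^sub>R u) \<le> 1" using h(2) by simp
    then have "f ((1 / R) *\<^sub>R u) \<in> closure (f ` {u \<in> D. nrm u \<le> 1})"
      using h(1) by (intro closure_subset[THEN subsetD] imageI) simp
    moreover have "f u = R *\<^sub>R f ((1 / R) *\<^sub>R u)" using h(3) R by simp
    ultimately show ?thesis by (intro image_eqI)
  qed
  then have "f ` {u \<in> D. nrm u \<le> r} \<subseteq> ?K" by blast
  moreover have "compact ?K"
    using assms(1) unfolding compact_map_def by (rule compact_scaling)
  ultimately show ?thesis by blast
qed

lemma compact_mapI:
  assumes "compact K" "\<And>u. u \<in> D \<Longrightarrow> nrm u \<le> 1 \<Longrightarrow> f u \<in> K"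
  shows "compact_map D nrm f"
proof -
  have "f ` {u \<in> D. nrm u \<le> 1} \<subseteq> K" using assms(2) by blast
  then have "closure (f ` {u \<in> D. nrm u \<le> 1}) \<subseteq> K"
    using assms(1) by (simp add: closure_minimal compact_imp_closed)
  then show ?thesis
    unfolding compact_map_def
    using compact_Int_closed[OF assms(1) closed_closure, of "f ` {u \<in> D. nrm u \<le> 1}"]
    by (simp add: Int_absorb1)
qed

text \<open>
  The resolvent is an isomorphism from the space onto the domain with the graph norm: \<open>u\<close> is the
  resolvent applied to \<open>z u - T u\<close>, whose norm is controlled by the graph norm of \<open>u\<close>, and conversely
  \<open>T u = z u - w\<close> if \<open>u\<close> is the resolvent applied to \<open>w\<close>. The embedding does not depend on \<open>z\<close>, so
  that compactness of the resolvent at one point entails it at all others.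
\<close>

lemma has_compact_resolvent_iff_compact_embedding:
  fixes T :: "'a::banach \<Rightarrow> 'a"
  assumes s: "banach_space_over s" and T: "linear_operator s s D T"
  shows "has_compact_resolvent s D T \<longleftrightarrow>
    resolvent_set s D T \<noteq> {} \<and> compact_map D (\<lambda>u. norm u + norm (T u)) (\<lambda>u. u)"
proof -
  note simps = banach_space_over_simps[OF s]
  have real_homogeneous: "c *\<^sub>R u \<in> D \<and> T (c *\<^sub>R u) = c *\<^sub>R T u" if "u \<in> D" for c u
    using linear_operator_imp_real[OF s s T] that by (auto simp: linear_operator_real_iff subspace_def)
  have embedding_compact: "compact_map D (\<lambda>u. norm u + norm (T u)) (\<lambda>u. u)"
    if z: "z \<in> resolvent_set s D T" "compact_map UNIV norm (resolvent s D T z)" for z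
  proof -
    have bij: "bij_betw (\<lambda>u. s z u - T u) D UNIV" and bl: "bounded_linear (resolvent s D T z)"
      using z(1) by (auto simp: resolvent_set_def bounded_operator_def)
    have "\<exists>K. compact K \<and> resolvent s D T z ` {u \<in> UNIV. norm u \<le> norm z + 1} \<subseteq> K"
      using bl by (intro precompact_bounded_part z(2)) (simp add: linear_simps)
    then obtain K where K: "compact K" "resolvent s D T z ` {u \<in> UNIV. norm u \<le> norm z + 1} \<subseteq> K"
      by blast
    show ?thesis
    proof (rule compact_mapI[OF K(1)])
      fix u assume u: "u \<in> D" "norm u + norm (T u) \<le> 1"
      have "norm (s z u - T u) \<le> norm z * norm u + norm (T u)"
        using norm_triangle_ineq4[of "s z u" "T u"] by (simp add: simps)
      moreover have "norm u \<le> 1" "norm (T u) \<le> 1"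
        using u(2) norm_ge_zero[of u] norm_ge_zero[of "T u"] by linarith+
      then have "norm z * norm u + norm (T u) \<le> norm z * 1 + 1"
        by (intro add_mono mult_left_mono) auto
      ultimately have "norm (s z u - T u) \<le> norm z + 1" by linarith
      then have "resolvent s D T z (s z u - T u) \<in> K" using K(2) by auto
      moreover have "resolvent s D T z (s z u - T u) = u"
        unfolding resolvent_def using bij u(1) by (intro inv_into_f_eq) (auto simp: bij_betw_def)
      ultimately show "u \<in> K" by simp
    qed
  qed
  have resolvent_compact: "compact_map UNIV norm (resolvent s D T z)"
    if emb: "compact_map D (\<lambda>u. norm u + norm (T u)) (\<lambda>u. u)" and z: "z \<in> resolvent_set s D T" for z
  proof -
    have bij: "bij_betw (\<lambda>u. s z u - T u) D UNIV" and bl: "bounded_linear (resolvent s D T z)"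
      using z by (auto simp: resolvent_set_def bounded_operator_def)
    obtain C where C: "C > 0" "\<And>w. norm (resolvent s D T z w) \<le> norm w * C"
      using bounded_linear.pos_bounded[OF bl] by blast
    let ?r = "C + (norm z * C + 1)"
    have "\<exists>K. compact K \<and> (\<lambda>u. u) ` {u \<in> D. norm u + norm (T u) \<le> ?r} \<subseteq> K"
      using real_homogeneous by (intro precompact_bounded_part emb) (simp add: distrib_left)
    then obtain K where K: "compact K" "{u \<in> D. norm u + norm (T u) \<le> ?r} \<subseteq> K" by auto
    show ?thesis
    proof (rule compact_mapI[OF K(1)])
      fix w :: 'a assume w: "norm w \<le> 1"
      let ?u = "resolvent s D T z w"
      have "w \<in> (\<lambda>u. s z u - T u) ` D" using bij by (simp add: bij_betw_def)
      then have u: "?u \<in> D" "s z ?u - T ?u = w"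
        unfolding resolvent_def by (rule inv_into_into, rule f_inv_into_f)
      have nu: "norm ?u \<le> C"
        using C(2)[of w] mult_right_mono[OF w, of C] C(1) by linarith
      have "T ?u = s z ?u - w" using u(2) by (simp add: algebra_simps)
      then have "norm (T ?u) \<le> norm z * norm ?u + norm w"
        using norm_triangle_ineq4[of "s z ?u" w] by (simp add: simps)
      also have "\<dots> \<le> norm z * C + 1" using nu w by (intro add_mono mult_left_mono) auto
      finally show "?u \<in> K" using u(1) nu K(2) by auto
    qed
  qed
  show ?thesis
    unfolding has_compact_resolvent_def using embedding_compact resolvent_compact by blast
qed

text \<open>
  Although the decay condition speaks of real scalars, the inverse of a \<open>'k\<close>-linear bijection is
  automatically \<open>'k\<close>-linear.
\<close>

lemma resolvent_decay_imp_resolvent_set: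
  fixes T :: "'a::banach \<Rightarrow> 'a"
  assumes s: "banach_space_over s" and T: "linear_operator s s D T" and "resolvent_decay D T"
  shows "resolvent_set s D T \<noteq> {}"
proof -
  note simps = banach_space_over_simps[OF s]
  note lin = T[unfolded linear_operator_iff[OF s]]
  obtain C l where C: "C > 0" "l > 0" "\<And>w. \<exists>u\<in>D. l *\<^sub>R u - T u = w"
    "\<And>u. u \<in> D \<Longrightarrow> l * norm u \<le> C * norm (l *\<^sub>R u - T u)"
    using assms(3) unfolding resolvent_decay_def by blast
  let ?z = "of_real l" let ?F = "\<lambda>u. s ?z u - T u"
  have inj: "inj_on ?F D"
  proof (rule inj_onI)
    fix u v assume uv: "u \<in> D" "v \<in> D" "?F u = ?F v"
    note d = linear_operator_real_diff[OF linear_operator_imp_real[OF s s T] uv(1,2)]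
    have "l *\<^sub>R (u - v) - T (u - v) = 0" using uv(3) by (simp add: d(2) simps scaleR_diff_right algebra_simps)
    then show "u = v" using C(4)[OF d(1)] C(2) by (simp add: mult_le_0_iff)
  qed
  have surj: "?F ` D = UNIV" using C(3) by (auto simp: simps image_iff) metis
  let ?R = "resolvent s D T ?z"
  have R: "?R w \<in> D" "?F (?R w) = w" for w
    unfolding resolvent_def using surj by (auto intro: inv_into_into f_inv_into_f)
  have R_eq: "?R w = u" if "u \<in> D" "?F u = w" for u w
    unfolding resolvent_def using inj that by (intro inv_into_f_eq)
  have R_add: "?R (v + w) = ?R v + ?R w" for v w
  proof (rule R_eq)
    show "?R v + ?R w \<in> D" using lin R by blast
    have "?F (?R v + ?R w) = ?F (?R v) + ?F (?R w)" using lin R(1) by (simp add: simps)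
    then show "?F (?R v + ?R w) = v + w" using R(2) by simp
  qed
  have R_scale: "?R (s c w) = s c (?R w)" for c w
  proof (rule R_eq)
    show "s c (?R w) \<in> D" using lin R by blast
    have "s ?z (s c (?R w)) = s c (s ?z (?R w))" by (simp only: simps(5) mult.commute)
    then have "?F (s c (?R w)) = s c (?F (?R w))" using lin R(1) by (simp add: simps(8))
    then show "?F (s c (?R w)) = s c w" using R(2) by simp
  qed
  have "bounded_linear ?R"
  proof (rule bounded_linear_intro)
    show "?R (v + w) = ?R v + ?R w" for v w by (rule R_add)
    show "?R (r *\<^sub>R w) = r *\<^sub>R ?R w" for r w using R_scale[of "of_real r" w] by (simp add: simps)
    show "norm (?R w) \<le> norm w * (C / l)" for w
      using C(4)[OF R(1)[of w]] R(2)[of w] C(2) by (simp add: simps field_simps)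
  qed
  then have "?z \<in> resolvent_set s D T"
    using inj surj R_scale by (simp add: resolvent_set_def bij_betw_def bounded_operator_def)
  then show ?thesis by blast
qed

lemma finite_dimensional_iff_compact_cball:
  fixes s :: "'k::{real_normed_field,euclidean_space} \<Rightarrow> 'a::banach \<Rightarrow> 'a"
  assumes "banach_space_over s"
  shows "finite_dimensional s \<longleftrightarrow> compact (cball (0::'a) 1)"
  unfolding finite_dimensional_iff_finite_real_span[OF assms]
  using compact_cball_finite_span compact_cball_imp_finite_span by metis

text \<open>
  A linear right inverse of \<open>R\<close> is determined by preimages of a basis. Since the boundary space is
  finite-dimensional, both the right inverse and its composition with the unbounded operator \<open>A\<close> are
  bounded.
\<close>

lemma linear_operator_bounded_right_inverse:
  fixes R :: "'y::real_normed_vector \<Rightarrow> 'd::real_normed_vector" and A :: "'y \<Rightarrow> 'x::real_normed_vector"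
  assumes R: "linear_operator scaleR scaleR D R" "R ` D = UNIV"
    and A: "linear_operator scaleR scaleR D A"
    and fin: "finite B" "span B = (UNIV :: 'd set)"
  shows "\<exists>E. (\<forall>y. E y \<in> D \<and> R (E y) = y) \<and> bounded_linear E \<and> bounded_linear (\<lambda>y. A (E y))"
proof -
  note R_lin = R(1)[unfolded linear_operator_real_iff] and A_lin = A[unfolded linear_operator_real_iff]
  obtain B' :: "'d set" where B': "B' \<subseteq> B" "independent B'" "B \<subseteq> span B'"
    using maximal_independent_subset[of B] by blast
  have "span B' = UNIV" using span_mono[OF B'(3)] fin(2) by (simp add: span_span top.extremum_unique)
  obtain E where E: "linear E" "\<And>b. b \<in> B' \<Longrightarrow> E b = inv_into D R b"
    using linear_independent_extend[OF B'(2), of "inv_into D R"] by metis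
  have right_inv: "E y \<in> D \<and> R (E y) = y" for y
  proof -
    have "y \<in> span B'" using \<open>span B' = UNIV\<close> by simp
    then show ?thesis
    proof (induction rule: span_induct_alt)
      case base
      then show ?case using E(1) R_lin linear_operator_real_diff(2)[OF R(1), of 0 0]
        by (simp add: linear_0 subspace_0)
    next
      case (step c b z)
      have b: "E b \<in> D" "R (E b) = b"
        using E(2)[OF step(1)] R(2) by (simp_all add: inv_into_into f_inv_into_f)
      have "E (c *\<^sub>R b + z) = c *\<^sub>R E b + E z" using E(1) by (simp add: linear_add linear_cmul)
      then show ?case using b step(2) R_lin by (simp add: subspace_add subspace_scale)
    qed
  qed
  have "linear (\<lambda>y. A (E y))"
  proof (rule linearI)
    show "A (E (v + w)) = A (E v) + A (E w)" for v w
      using A_lin right_inv E(1) by (simp add: linear_add)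
    show "A (E (c *\<^sub>R v)) = c *\<^sub>R A (E v)" for c v
      using A_lin right_inv E(1) by (simp add: linear_cmul)
  qed
  then have "bounded_linear (\<lambda>y. A (E y))" "bounded_linear E"
    using E(1) by (auto intro: linear_finite_span_imp_bounded_linear[OF fin])
  then show ?thesis using right_inv by (intro exI[of _ E]) simp
qed

section \<open>The boundary value problem\<close>

locale boundary_problem =
  fixes sX :: "'k::{real_normed_field,euclidean_space} \<Rightarrow> 'x::banach \<Rightarrow> 'x"
    and sY :: "'k \<Rightarrow> 'y::banach \<Rightarrow> 'y"
    and sd :: "'k \<Rightarrow> 'd::banach \<Rightarrow> 'd"
    and j :: "'y \<Rightarrow> 'x"
    and DA :: "'y set"
    and A :: "'y \<Rightarrow> 'x"
    and R :: "'y \<Rightarrow> 'd"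
    and B1 B2 :: "'y \<Rightarrow> 'd"
    and B3 B4 :: "'d \<Rightarrow> 'd"
  assumes sX: "banach_space_over sX" and sY: "banach_space_over sY" and sd: "banach_space_over sd"
    and emb: "continuous_embedding sY sX j"
    and A: "linear_operator sY sX DA A"
    and R: "linear_operator sY sd DA R" and R_onto: "R ` DA = UNIV"
    and B1: "bounded_operator sY sd B1" and B2: "bounded_operator sY sd B2"
    and B3: "bounded_operator sd sd B3" and B4: "bounded_operator sd sd B4"
    and cosine: "generates_cosine_function sY sX j (ker_dom DA R) A"
begin

lemma bl: "bounded_linear j" "bounded_linear B1" "bounded_linear B2" "bounded_linear B3" "bounded_linear B4"
  and scale_j: "j (sY c u) = sX c (j u)"
  and scale_B: "B1 (sY c u) = sd c (B1 u)" "B2 (sY c u) = sd c (B2 u)"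
    "B3 (sd c x) = sd c (B3 x)" "B4 (sd c x) = sd c (B4 x)"
  and inj_j: "inj j"
  using emb B1 B2 B3 B4 by (auto simp: continuous_embedding_def bounded_operator_def)

lemma inv_j: "inv j (j v) = v"
  using inj_j by simp

lemmas bl_simps = bl[THEN bounded_linear.linear, THEN linear_add]
  bl[THEN bounded_linear.linear, THEN linear_diff]
  bl[THEN bounded_linear.linear, THEN linear_0]
  bl[THEN bounded_linear.linear, THEN linear_cmul]

lemma A_lin: "0 \<in> DA" "u \<in> DA \<Longrightarrow> v \<in> DA \<Longrightarrow> u + v \<in> DA" "u \<in> DA \<Longrightarrow> sY c u \<in> DA"
    "u \<in> DA \<Longrightarrow> v \<in> DA \<Longrightarrow> A (u + v) = A u + A v" "u \<in> DA \<Longrightarrow> A (sY c u) = sX c (A u)"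
    "u \<in> DA \<Longrightarrow> v \<in> DA \<Longrightarrow> R (u + v) = R u + R v" "u \<in> DA \<Longrightarrow> R (sY c u) = sd c (R u)"
    "A 0 = 0" "R 0 = 0"
proof -
  show *: "0 \<in> DA" "u \<in> DA \<Longrightarrow> v \<in> DA \<Longrightarrow> u + v \<in> DA" "u \<in> DA \<Longrightarrow> sY c u \<in> DA"
    "u \<in> DA \<Longrightarrow> v \<in> DA \<Longrightarrow> A (u + v) = A u + A v" "u \<in> DA \<Longrightarrow> A (sY c u) = sX c (A u)"
    "u \<in> DA \<Longrightarrow> v \<in> DA \<Longrightarrow> R (u + v) = R u + R v" "u \<in> DA \<Longrightarrow> R (sY c u) = sd c (R u)"
    for u v c
    using A[unfolded linear_operator_iff[OF sY]] R[unfolded linear_operator_iff[OF sY]] by blast+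
  show "A 0 = 0" "R 0 = 0" using *(4)[of 0 0] *(6)[of 0 0] *(1) by auto
qed

lemmas real_A = linear_operator_imp_real[OF sY sX A]
lemmas real_R = linear_operator_imp_real[OF sY sd R]

lemma phase_resolvent_decay: "resolvent_decay (phase_dom j (ker_dom DA R)) (phase_op j A)"
  and phase_linear: "linear_operator scaleR scaleR (phase_dom j (ker_dom DA R)) (phase_op j A)"
  using cosine generator_linear_and_resolvent_decay unfolding generates_cosine_function_def by blast+

text \<open>
  The phase operator maps \<open>(u, l u)\<close> to \<open>(l u, A u)\<close>, so applying the resolvent estimate to this
  vector bounds the norm of \<open>u\<close> in \<open>Y\<close> by the norm of \<open>l\<^sup>2 u - A u\<close> in \<open>X\<close>.
\<close>

lemma norm_le_graph_norm:
  "\<exists>C>0. \<forall>u\<in>ker_dom DA R. norm u \<le> C * (norm (j u) + norm (A u))"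
proof -
  obtain C l where C: "C > 0" "l > 0" "\<And>p. p \<in> phase_dom j (ker_dom DA R) \<Longrightarrow>
      l * norm p \<le> C * norm (l *\<^sub>R p - phase_op j A p)"
    using phase_resolvent_decay unfolding resolvent_decay_def by blast
  have "norm u \<le> C / l * (l\<^sup>2 + 1) * (norm (j u) + norm (A u))" if u: "u \<in> ker_dom DA R" for u
  proof -
    let ?p = "(u, j (l *\<^sub>R u))"
    have eq: "l *\<^sub>R ?p - phase_op j A ?p = (0, l\<^sup>2 *\<^sub>R j u - A u)"
      by (simp add: phase_op_def inv_j) (simp add: bl_simps power2_eq_square)
    have "l * norm u \<le> l * norm ?p" using C(2) norm_fst_le[of u "j (l *\<^sub>R u)"] by simp
    also have "\<dots> \<le> C * norm (l\<^sup>2 *\<^sub>R j u - A u)"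
      using C(3)[of ?p] u unfolding eq by (auto simp: phase_dom_def norm_Pair)
    also have "norm (l\<^sup>2 *\<^sub>R j u - A u) \<le> l\<^sup>2 * norm (j u) + norm (A u)"
      using norm_triangle_ineq4[of "l\<^sup>2 *\<^sub>R j u" "A u"] by simp
    also have "\<dots> \<le> (l\<^sup>2 + 1) * (norm (j u) + norm (A u))"
      by (simp add: algebra_simps)
    finally show ?thesis using C(1,2) by (simp add: field_simps)
  qed
  moreover have "C / l * (l\<^sup>2 + 1) > 0" using C by (intro mult_pos_pos) (auto simp: add_nonneg_pos)
  ultimately show ?thesis by blast
qed

text \<open>
  The suffix \<open>small\<close> refers to the operator on \<open>Y \<times> X \<times> \<partial>X\<close>, the suffix \<open>full\<close> to the one on
  \<open>Y \<times> X \<times> \<partial>X \<times> \<partial>X\<close>.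
\<close>

abbreviation "scale_small \<equiv> scale2 sY (scale2 sX sd)"
abbreviation "scale_full \<equiv> scale2 sY (scale2 sX (scale2 sd sd))"

lemmas spaces = sX sY sd banach_space_over_scale2[OF sd sd]
  banach_space_over_scale2[OF sX sd] banach_space_over_scale2[OF sX banach_space_over_scale2[OF sd sd]]
  banach_space_over_scale2[OF sY banach_space_over_scale2[OF sX sd]]
  banach_space_over_scale2[OF sY banach_space_over_scale2[OF sX banach_space_over_scale2[OF sd sd]]]

lemma scale_small: "scale_small c (u, w, x) = (sY c u, sX c w, sd c x)"
  by (simp add: scale2_Pair spaces)

lemma scale_full: "scale_full c (u, w, x, y) = (sY c u, sX c w, sd c x, sd c y)"
  by (simp add: scale2_Pair spaces)

lemma bbA0_dom_iff: "(u, w, x) \<in> bbA0_dom j DA R \<longleftrightarrow> u \<in> DA \<and> R u = 0 \<and> (\<exists>v. w = j v)"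
  by (auto simp: bbA0_dom_def ker_dom_def)

lemma calA_dom_iff: "(u, w, x, y) \<in> calA_dom j DA R \<longleftrightarrow> u \<in> DA \<and> R u = y \<and> (\<exists>v. w = j v)"
  by (auto simp: calA_dom_def)

lemma linear_bbA0: "linear_operator scale_small scale_small (bbA0_dom j DA R) (bbA0 j A B2)"
  unfolding linear_operator_iff[OF spaces(7)]
proof (intro conjI allI ballI)
  note simps = bbA0_dom_iff bbA0_def A_lin inv_j scale_small scale_B
    bl_simps(1)[symmetric] bl_simps(2-5) scale_j[symmetric] banach_space_over_simps(6)[OF sd]
  show "0 \<in> bbA0_dom j DA R" by (auto simp: zero_prod_def bbA0_dom_iff A_lin bl_simps intro: exI[of _ 0])
  show "p + q \<in> bbA0_dom j DA R" "bbA0 j A B2 (p + q) = bbA0 j A B2 p + bbA0 j A B2 q"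
    if "p \<in> bbA0_dom j DA R" "q \<in> bbA0_dom j DA R" for p q
    using that by (cases p; cases q; auto simp: simps)+
  show "scale_small c p \<in> bbA0_dom j DA R" "bbA0 j A B2 (scale_small c p) = scale_small c (bbA0 j A B2 p)"
    if "p \<in> bbA0_dom j DA R" for c p
    using that by (cases p; auto simp: simps)+
qed

lemma linear_calA: "linear_operator scale_full scale_full (calA_dom j DA R) (calA j A R B1 B2 B3 B4)"
  unfolding linear_operator_iff[OF spaces(8)]
proof (intro conjI allI ballI)
  note simps = calA_dom_iff calA_def A_lin inv_j scale_full scale_B banach_space_over_simps(3)[OF sd]
  show "0 \<in> calA_dom j DA R" by (auto simp: zero_prod_def calA_dom_iff A_lin bl_simps intro: exI[of _ 0])
  show "p + q \<in> calA_dom j DA R" "calA j A R B1 B2 B3 B4 (p + q) = calA j A R B1 B2 B3 B4 p + calA j A R B1 B2 B3 B4 q"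
    if "p \<in> calA_dom j DA R" "q \<in> calA_dom j DA R" for p q
    using that by (cases p; cases q; auto simp: simps bl_simps(2-5) bl_simps(1)[symmetric])+
  show "scale_full c p \<in> calA_dom j DA R"
    "calA j A R B1 B2 B3 B4 (scale_full c p) = scale_full c (calA j A R B1 B2 B3 B4 p)"
    if "p \<in> calA_dom j DA R" for c p
    using that by (cases p; auto simp: simps scale_j[symmetric])+
qed


abbreviation "dom_small \<equiv> bbA0_dom j DA R"
abbreviation "op_small \<equiv> bbA0 j A B2"
abbreviation "dom_full \<equiv> calA_dom j DA R"
abbreviation "op_full \<equiv> calA j A R B1 B2 B3 B4"

lemma real_scale:
  "u \<in> ker_dom DA R \<Longrightarrow> c *\<^sub>R u \<in> ker_dom DA R \<and> A (c *\<^sub>R u) = c *\<^sub>R A u"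
  "p \<in> dom_small \<Longrightarrow> c *\<^sub>R p \<in> dom_small \<and> op_small (c *\<^sub>R p) = c *\<^sub>R op_small p"
  "q \<in> dom_full \<Longrightarrow> c *\<^sub>R q \<in> dom_full \<and> op_full (c *\<^sub>R q) = c *\<^sub>R op_full q"
  using real_A real_R linear_operator_imp_real[OF spaces(7) spaces(7) linear_bbA0]
    linear_operator_imp_real[OF spaces(8) spaces(8) linear_calA]
  by (auto simp: linear_operator_real_iff subspace_def ker_dom_def)

text \<open>
  After re-association of the product, the operator is the phase operator extended by zero plus the
  bounded operator whose only entry is \<open>B2\<close>.
\<close>

lemma resolvent_set_small: "resolvent_set scale_small dom_small op_small \<noteq> {}"
proof -
  let ?T = "\<lambda>q. (case q of (p, x) \<Rightarrow> (phase_op j A p, 0)) + ((0, 0), B2 (fst (fst q)))"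
  have "bounded_linear (\<lambda>q. ((0::'y, 0::'x), B2 (fst (fst (q :: ('y \<times> 'x) \<times> 'd)))))"
    by (intro bounded_linear_Pair bounded_linear_zero bounded_linear_compose[OF bl(3)]
        bounded_linear_fst_comp bounded_linear_fst)
  then have "resolvent_decay (phase_dom j (ker_dom DA R) \<times> UNIV) ?T"
    by (intro resolvent_decay_bounded_perturbation resolvent_decay_extend_by_zero
        linear_operator_real_extend_by_zero phase_resolvent_decay phase_linear)
  then have "resolvent_decay dom_small op_small"
  proof (rule resolvent_decay_similarity)
    show "bounded_linear (\<lambda>p :: 'y \<times> 'x \<times> 'd. ((fst p, fst (snd p)), snd (snd p)))"
      by (intro bounded_linear_Pair bounded_linear_fst bounded_linear_fst_comp bounded_linear_snd_comp
          bounded_linear_snd)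
    show "bounded_linear (\<lambda>q :: ('y \<times> 'x) \<times> 'd. (fst (fst q), snd (fst q), snd q))"
      by (intro bounded_linear_Pair bounded_linear_fst bounded_linear_fst_comp bounded_linear_snd_comp
          bounded_linear_snd)
  qed (auto simp: bbA0_dom_def phase_dom_def bbA0_def phase_op_def)
  then show ?thesis
    by (rule resolvent_decay_imp_resolvent_set[OF spaces(7) linear_bbA0])
qed

text \<open>
  The coupling \<open>R u = y\<close> in the domain is removed by the substitution \<open>u \<mapsto> u - E y\<close>, with \<open>E\<close> a
  bounded right inverse of \<open>R\<close>: the new first component lies in the kernel of \<open>R\<close>. In the new
  coordinates the operator is the phase operator extended by zero, plus an operator that contains
  \<open>A\<close> only through \<open>A E\<close> and is therefore bounded. Its first entry \<open>- E k\<close>, where \<open>k\<close> is the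
  fourth component of the image, stems from the transformation of the image.
\<close>

lemma resolvent_set_full:
  assumes "\<And>y. E y \<in> DA \<and> R (E y) = y" and E: "bounded_linear E" and AE: "bounded_linear (\<lambda>y. A (E y))"
  shows "resolvent_set scale_full dom_full op_full \<noteq> {}"
proof -
  let ?u = "\<lambda>q :: ('y \<times> 'x) \<times> 'd \<times> 'd. fst (fst q) + E (snd (snd q))"
  let ?k = "\<lambda>q. B1 (?u q) + B4 (B2 (?u q)) + B3 (fst (snd q)) + B4 (snd (snd q))"
  let ?B = "\<lambda>q. ((- E (?k q), A (E (snd (snd q)))), (snd (snd q) + B2 (?u q), ?k q))"
  let ?T = "\<lambda>q. (case q of (p, x) \<Rightarrow> (phase_op j A p, 0)) + ?B q"
  note intros = bounded_linear_Pair bounded_linear_add bounded_linear_sub bounded_linear_minus bl[THEN bounded_linear_compose]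
    E[THEN bounded_linear_compose] AE[THEN bounded_linear_compose]
    bounded_linear_fst bounded_linear_snd bounded_linear_fst_comp bounded_linear_snd_comp
  have "bounded_linear ?B" by (intro intros)
  then have "resolvent_decay (phase_dom j (ker_dom DA R) \<times> UNIV) ?T"
    by (intro resolvent_decay_bounded_perturbation resolvent_decay_extend_by_zero
        linear_operator_real_extend_by_zero phase_resolvent_decay phase_linear)
  then have "resolvent_decay dom_full op_full"
  proof (rule resolvent_decay_similarity)
    let ?U = "\<lambda>p :: 'y \<times> 'x \<times> 'd \<times> 'd. ((fst p - E (snd (snd (snd p))), fst (snd p)), snd (snd p))"
    let ?V = "\<lambda>q :: ('y \<times> 'x) \<times> 'd \<times> 'd. (?u q, snd (fst q), snd q)"
    show "bounded_linear ?U" "bounded_linear ?V" by (intro intros)+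
    show "?V (?U p) = p" "?U (?V q) = q" for p q by simp_all
    note diff_R = linear_operator_real_diff[OF real_R] and diff_A = linear_operator_real_diff[OF real_A]
    show "p \<in> dom_full \<longleftrightarrow> ?U p \<in> phase_dom j (ker_dom DA R) \<times> UNIV" for p
    proof -
      obtain u w x y where p: "p = (u, w, x, y)" by (cases p) auto
      have "u - E y \<in> DA \<and> R (u - E y) = 0 \<longleftrightarrow> u \<in> DA \<and> R u = y"
      proof
        assume "u \<in> DA \<and> R u = y"
        then show "u - E y \<in> DA \<and> R (u - E y) = 0" using diff_R[of u "E y"] assms(1) by simp
      next
        assume "u - E y \<in> DA \<and> R (u - E y) = 0"
        then have "(u - E y) + E y \<in> DA" "R ((u - E y) + E y) = 0 + y"
          using A_lin(2,6)[of "u - E y" "E y"] assms(1) by simp_all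
        then show "u \<in> DA \<and> R u = y" by simp
      qed
      then show ?thesis by (auto simp: p calA_dom_iff phase_dom_def ker_dom_def)
    qed
    show "op_full p = ?V (?T (?U p))" if p_in: "p \<in> dom_full" for p
    proof -
      obtain u v x where p: "p = (u, j v, x, R u)" "u \<in> DA" using p_in by (auto simp: calA_dom_def)
      show ?thesis
        using diff_A(2)[OF p(2), of "E (R u)"] assms(1)
        by (simp add: p calA_def phase_op_def)
    qed
  qed
  then show ?thesis
    by (rule resolvent_decay_imp_resolvent_set[OF spaces(8) linear_calA])
qed

section \<open>The equivalence\<close>

text \<open>
  The map \<open>(u, w, x) \<mapsto> (u, w, x, 0)\<close> sends the domain of the small operator into that of the full one,
  because \<open>R u = 0\<close> there. On its image the two operators differ only by the bounded fourth component,
  so graph-norm balls go to graph-norm bounded sets and compactness is inherited by projecting back.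
\<close>

lemma compact_resolvent_full_imp_small:
  assumes "has_compact_resolvent scale_full dom_full op_full"
  shows "has_compact_resolvent scale_small dom_small op_small"
proof -
  have emb: "compact_map dom_full (\<lambda>q. norm q + norm (op_full q)) (\<lambda>q. q)"
    using assms has_compact_resolvent_iff_compact_embedding[OF spaces(8) linear_calA] by blast
  let ?F = "\<lambda>p. B1 (fst p) + B4 (B2 (fst p)) + B3 (snd (snd p)) :: 'd"
  have "bounded_linear (?F :: 'y \<times> 'x \<times> 'd \<Rightarrow> 'd)"
    by (intro bounded_linear_add bl[THEN bounded_linear_compose] bounded_linear_fst
        bounded_linear_snd_comp bounded_linear_snd)
  then obtain C where C: "C > 0" "\<And>p. norm (?F p) \<le> norm (p :: 'y \<times> 'x \<times> 'd) * C"
    using bounded_linear.pos_bounded by blast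
  have "\<exists>K. compact K \<and> (\<lambda>q. q) ` {q \<in> dom_full. norm q + norm (op_full q) \<le> 1 + C} \<subseteq> K"
    using real_scale(3) by (intro precompact_bounded_part emb) (simp add: distrib_left)
  then obtain K where K: "compact K" "{q \<in> dom_full. norm q + norm (op_full q) \<le> 1 + C} \<subseteq> K" by auto
  let ?pr = "\<lambda>q :: 'y \<times> 'x \<times> 'd \<times> 'd. (fst q, fst (snd q), fst (snd (snd q)))"
  have "compact_map dom_small (\<lambda>p. norm p + norm (op_small p)) (\<lambda>p. p)"
  proof (rule compact_mapI)
    show "compact (?pr ` K)" using K(1) by (intro compact_continuous_image continuous_intros)
    fix p assume p: "p \<in> dom_small" and le: "norm p + norm (op_small p) \<le> 1"
    obtain u v x where p_eq: "p = (u, j v, x)" and u: "u \<in> DA" "R u = 0"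
      using p by (auto simp: bbA0_dom_def ker_dom_def)
    let ?q = "(u, j v, x, 0::'d)"
    have q_dom: "?q \<in> dom_full" using u by (auto simp: calA_dom_def)
    have "norm ?q = norm p" by (simp add: p_eq norm_Pair)
    moreover have "norm (op_full ?q) \<le> norm (op_small p) + C * norm p"
    proof -
      have "op_full ?q = (v, A u, B2 u, ?F p)" by (simp add: calA_def p_eq inv_j u bl_simps)
      moreover have "op_small p = (v, A u, B2 u)" by (simp add: bbA0_def p_eq inv_j)
      moreover have "norm (v, A u, B2 u, ?F p) \<le> norm (v, A u, B2 u) + norm (?F p)"
      proof -
        have "(v, A u, B2 u, ?F p) = (v, A u, B2 u, 0) + (0, 0, 0, ?F p)" by simp
        then have "norm (v, A u, B2 u, ?F p) \<le> norm (v, A u, B2 u, 0::'d) + norm (0::'y, 0::'x, 0::'d, ?F p)"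
          by (metis norm_triangle_ineq)
        then show ?thesis by (simp add: norm_Pair)
      qed
      ultimately show ?thesis using C(2)[of p] by (simp add: mult.commute)
    qed
    moreover have "C * norm p \<le> C * 1"
      using le C(1) norm_ge_zero[of "op_small p"] by (intro mult_left_mono) linarith+
    ultimately have "norm ?q + norm (op_full ?q) \<le> 1 + C" using le by linarith
    then have "?q \<in> K" using K(2) q_dom by blast
    then have "?pr ?q \<in> ?pr ` K" by (rule imageI)
    then show "p \<in> ?pr ` K" by (simp add: p_eq)
  qed
  then show ?thesis
    using resolvent_set_small has_compact_resolvent_iff_compact_embedding[OF spaces(7) linear_bbA0] by blast
qed

text \<open>
  Three kinds of vectors whose graph norm is controlled are tested: \<open>(0, 0, x)\<close> is mapped to zero and
  shows that the unit ball of \<open>\<partial>X\<close> is compact; \<open>(0, v, 0)\<close> is mapped to \<open>(v, 0, 0)\<close>, which yields the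
  embedding of \<open>Y\<close> into \<open>X\<close>; and \<open>(u, 0, 0)\<close> is mapped to \<open>(0, A u, B2 u)\<close>, which yields the embedding
  of the domain of \<open>A\<^sub>0\<close>, as its graph norm dominates the norm of \<open>Y\<close>.
\<close>

lemma compact_resolvent_small_imp_compactness:
  assumes "has_compact_resolvent scale_small dom_small op_small"
  shows "finite_dimensional sd"
    and "compact_map (ker_dom DA R) (\<lambda>u. norm (j u) + norm (A u)) (\<lambda>u. u)"
    and "compact_map UNIV norm j"
proof -
  have emb: "compact_map dom_small (\<lambda>p. norm p + norm (op_small p)) (\<lambda>p. p)"
    using assms has_compact_resolvent_iff_compact_embedding[OF spaces(7) linear_bbA0] by blast
  have precompact: "\<exists>K. compact K \<and> {p \<in> dom_small. norm p + norm (op_small p) \<le> r} \<subseteq> K" for r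
  proof -
    have "\<exists>K. compact K \<and> (\<lambda>p. p) ` {p \<in> dom_small. norm p + norm (op_small p) \<le> r} \<subseteq> K"
      using real_scale(2) by (intro precompact_bounded_part emb) (simp add: distrib_left)
    then show ?thesis by simp
  qed
  have norm3: "norm (u, w, x) \<le> norm u + norm w + norm x" for u :: 'y and w :: 'x and x :: 'd
    using norm_Pair_le[of u "(w, x)"] norm_Pair_le[of w x] by simp
  have op: "op_small (u, j v, x) = (v, A u, B2 u)" for u v x by (simp add: bbA0_def inv_j)
  have op0: "op_small (u, 0, x) = (0, A u, B2 u)" for u x using op[of u 0 x] by (simp add: bl_simps)
  have dom0: "(u, 0, x) \<in> dom_small" if "u \<in> ker_dom DA R" for u x
    using that bl_simps(11) by (auto simp: bbA0_dom_iff ker_dom_def intro: exI[of _ 0])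
  have zero: "0 \<in> ker_dom DA R" by (simp add: ker_dom_def A_lin)
  show "finite_dimensional sd"
  proof -
    obtain K where K: "compact K" "{p \<in> dom_small. norm p + norm (op_small p) \<le> 1} \<subseteq> K"
      using precompact by blast
    have "cball 0 1 \<subseteq> (\<lambda>p. snd (snd p)) ` K"
    proof
      fix x :: 'd assume "x \<in> cball 0 1"
      then have "(0, 0, x) \<in> K" using K(2) dom0[OF zero, of x] op0[of 0 x]
        by (auto simp: A_lin bl_simps norm_Pair subset_iff)
      then show "x \<in> (\<lambda>p. snd (snd p)) ` K" by (rule image_eqI[rotated]) simp
    qed
    moreover have "compact ((\<lambda>p. snd (snd p)) ` K)"
      using K(1) by (intro compact_continuous_image continuous_intros)
    ultimately have "compact (cball (0::'d) 1)"
      using compact_Int_closed[OF _ closed_cball, of "(\<lambda>p. snd (snd p)) ` K" 0 1]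
      by (simp add: Int_absorb1)
    then show ?thesis using finite_dimensional_iff_compact_cball[OF sd] by blast
  qed
  show "compact_map UNIV norm j"
  proof -
    obtain C where C: "C > 0" "\<And>v. norm (j v) \<le> norm v * C"
      using bounded_linear.pos_bounded[OF bl(1)] by blast
    obtain K where K: "compact K" "{p \<in> dom_small. norm p + norm (op_small p) \<le> C + 1} \<subseteq> K"
      using precompact by blast
    show ?thesis
    proof (rule compact_mapI)
      show "compact ((\<lambda>p. fst (snd p)) ` K)"
        using K(1) by (intro compact_continuous_image continuous_intros)
      fix v :: 'y assume v: "norm v \<le> 1"
      have "norm (j v) \<le> C" using C(2)[of v] mult_right_mono[OF v, of C] C(1) by linarith
      moreover have "(0, j v, 0) \<in> dom_small"
        using zero by (auto simp: bbA0_dom_def)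
      moreover have "norm (0::'y, j v, 0::'d) = norm (j v)" by (simp add: norm_Pair)
      moreover have "norm (op_small (0, j v, 0)) = norm v"
        by (simp add: op A_lin bl_simps norm_Pair)
      ultimately have "(0, j v, 0) \<in> K" using K(2) v by (auto simp: subset_iff)
      then show "j v \<in> (\<lambda>p. fst (snd p)) ` K" by (rule image_eqI[rotated]) simp
    qed
  qed
  show "compact_map (ker_dom DA R) (\<lambda>u. norm (j u) + norm (A u)) (\<lambda>u. u)"
  proof -
    obtain C where C: "C > 0" "\<And>u. u \<in> ker_dom DA R \<Longrightarrow> norm u \<le> C * (norm (j u) + norm (A u))"
      using norm_le_graph_norm by blast
    obtain b where b: "b > 0" "\<And>v. norm (B2 v) \<le> norm v * b"
      using bounded_linear.pos_bounded[OF bl(3)] by blast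
    obtain K where K: "compact K" "{p \<in> dom_small. norm p + norm (op_small p) \<le> C + (1 + C * b)} \<subseteq> K"
      using precompact by blast
    show ?thesis
    proof (rule compact_mapI)
      show "compact (fst ` K)"
        using K(1) by (intro compact_continuous_image continuous_intros)
      fix u assume u: "u \<in> ker_dom DA R" "norm (j u) + norm (A u) \<le> 1"
      have nu: "norm u \<le> C" using C(2)[OF u(1)] mult_left_mono[OF u(2), of C] C(1) by linarith
      have "norm (B2 u) \<le> C * b" using b(2)[of u] mult_right_mono[OF nu, of b] b(1) by linarith
      moreover have "norm (A u) \<le> 1" using u(2) norm_ge_zero[of "j u"] by linarith
      ultimately have "norm (op_small (u, 0, 0)) \<le> 1 + C * b"
        using norm3[of 0 "A u" "B2 u"] by (simp add: op0)
      moreover have "norm (u, 0::'x, 0::'d) = norm u" by (simp add: norm_Pair)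
      ultimately have "(u, 0, 0) \<in> K" using K(2) dom0[OF u(1)] nu by (auto simp: subset_iff)
      then show "u \<in> fst ` K" by (rule image_eqI[rotated]) simp
    qed
  qed
qed

text \<open>
  Let \<open>(u, v, x, y)\<close> with \<open>y = R u\<close> be in the unit ball of the graph norm. Then \<open>v\<close> is bounded in \<open>Y\<close>,
  hence precompact in \<open>X\<close>; \<open>x\<close> and \<open>y\<close> are in a compact ball of \<open>\<partial>X\<close>; and \<open>u\<close> is the sum of \<open>E y\<close>, in
  a compact set, and of \<open>u - E y\<close>, which is bounded in the graph norm of \<open>A\<^sub>0\<close>.
\<close>

lemma compactness_imp_compact_resolvent_full:
  assumes fin: "finite_dimensional sd"
    and cA: "compact_map (ker_dom DA R) (\<lambda>u. norm (j u) + norm (A u)) (\<lambda>u. u)"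
    and cj: "compact_map UNIV norm j"
  shows "has_compact_resolvent scale_full dom_full op_full"
proof -
  obtain B where B: "finite B" "span B = (UNIV :: 'd set)"
    using fin finite_dimensional_iff_finite_real_span[OF sd] by blast
  obtain E where E: "\<And>y. E y \<in> DA \<and> R (E y) = y" "bounded_linear E" "bounded_linear (\<lambda>y. A (E y))"
    using linear_operator_bounded_right_inverse[OF real_R R_onto real_A B] by blast
  have "bounded_linear (\<lambda>y. j (E y))" using bl(1) E(2) by (rule bounded_linear_compose)
  then obtain a where a: "a > 0" "\<And>y. norm (j (E y)) \<le> norm y * a"
    using bounded_linear.pos_bounded by blast
  obtain b where b: "b > 0" "\<And>y. norm (A (E y)) \<le> norm y * b"
    using bounded_linear.pos_bounded[OF E(3)] by blast
  obtain c where c: "c > 0" "\<And>u. norm (j u) \<le> norm u * c"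
    using bounded_linear.pos_bounded[OF bl(1)] by blast
  have "\<exists>K. compact K \<and> (\<lambda>u. u) ` {u \<in> ker_dom DA R. norm (j u) + norm (A u) \<le> c + a + (1 + b)} \<subseteq> K"
    using real_scale(1) by (intro precompact_bounded_part cA) (simp add: distrib_left bl_simps)
  then obtain K where K: "compact K" "{u \<in> ker_dom DA R. norm (j u) + norm (A u) \<le> c + a + (1 + b)} \<subseteq> K"
    by auto
  let ?ball = "cball (0::'d) 1"
  let ?J = "closure (j ` {v \<in> UNIV. norm v \<le> 1})"
  let ?Y = "{p + q | p q. p \<in> K \<and> q \<in> E ` ?ball}"
  have ball: "compact ?ball" using fin finite_dimensional_iff_compact_cball[OF sd] by blast
  have "compact (E ` ?ball)"
    using ball by (intro compact_continuous_image bounded_linear.continuous_on[OF E(2)] continuous_on_id)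
  then have cpt: "compact (?Y \<times> ?J \<times> ?ball \<times> ?ball)"
    using cj ball K(1) unfolding compact_map_def by (intro compact_Times compact_sums)
  have "compact_map dom_full (\<lambda>p. norm p + norm (op_full p)) (\<lambda>p. p)"
  proof (rule compact_mapI[OF cpt])
    fix p assume p: "p \<in> dom_full" and le: "norm p + norm (op_full p) \<le> 1"
    obtain u v x where p_eq: "p = (u, j v, x, R u)" and u: "u \<in> DA"
      using p by (auto simp: calA_dom_def)
    have np: "norm p \<le> 1" "norm (op_full p) \<le> 1"
      using le norm_ge_zero[of p] norm_ge_zero[of "op_full p"] by linarith+
    have "norm u \<le> norm p" "norm x \<le> norm p" "norm (R u) \<le> norm p"
      unfolding p_eq by (rule order_trans[OF _ norm_snd_le] norm_fst_le norm_snd_le)+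
    then have n: "norm u \<le> 1" "norm x \<le> 1" "norm (R u) \<le> 1" using np by auto
    have op: "op_full p = (v, A u, snd (snd (op_full p)))" by (simp add: p_eq calA_def inv_j)
    have "norm v \<le> norm (op_full p)" by (subst op) (rule norm_fst_le)
    moreover have "norm (A u) \<le> norm (op_full p)"
      by (subst op) (rule order_trans[OF norm_fst_le norm_snd_le])
    ultimately have n': "norm v \<le> 1" "norm (A u) \<le> 1" using np by auto
    let ?u = "u - E (R u)"
    have ker: "?u \<in> ker_dom DA R"
      using linear_operator_real_diff[OF real_R u, of "E (R u)"] E(1) by (simp add: ker_dom_def)
    have "norm (j ?u) \<le> c + a"
    proof -
      have "norm (j ?u) \<le> norm (j u) + norm (j (E (R u)))" by (simp add: bl_simps norm_triangle_ineq4)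
      moreover have "norm (j u) \<le> c" using c(2)[of u] mult_right_mono[OF n(1), of c] c(1) by linarith
      moreover have "norm (j (E (R u))) \<le> a" using a(2)[of "R u"] mult_right_mono[OF n(3), of a] a(1) by linarith
      ultimately show ?thesis by linarith
    qed
    moreover have "norm (A ?u) \<le> 1 + b"
    proof -
      have "A ?u = A u - A (E (R u))" using linear_operator_real_diff[OF real_A u] E(1) by blast
      then have "norm (A ?u) \<le> norm (A u) + norm (A (E (R u)))" by (simp add: norm_triangle_ineq4)
      moreover have "norm (A (E (R u))) \<le> b" using b(2)[of "R u"] mult_right_mono[OF n(3), of b] b(1) by linarith
      ultimately show ?thesis using n' by linarith
    qed
    ultimately have "?u \<in> K" using K(2) ker by auto
    moreover have "E (R u) \<in> E ` ?ball" using n by auto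
    moreover have "u = ?u + E (R u)" by simp
    ultimately have "u \<in> ?Y" by blast
    moreover have "j v \<in> ?J" using n' by (intro closure_subset[THEN subsetD] imageI) simp
    ultimately show "p \<in> ?Y \<times> ?J \<times> ?ball \<times> ?ball" using n by (simp add: p_eq)
  qed
  then show ?thesis
    using resolvent_set_full[OF E] has_compact_resolvent_iff_compact_embedding[OF spaces(8) linear_calA] by blast
qed

end

theorem theorem3p12:
  fixes sX :: "'k::{real_normed_field,euclidean_space} \<Rightarrow> 'x::banach \<Rightarrow> 'x"
    and sY :: "'k \<Rightarrow> 'y::banach \<Rightarrow> 'y"
    and sd :: "'k \<Rightarrow> 'd::banach \<Rightarrow> 'd"
    and j :: "'y \<Rightarrow> 'x"
    and DA :: "'y set"
    and A :: "'y \<Rightarrow> 'x"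
    and R :: "'y \<Rightarrow> 'd"
    and B1 B2 :: "'y \<Rightarrow> 'd"
    and B3 B4 :: "'d \<Rightarrow> 'd"
  assumes "banach_space_over sX" and "banach_space_over sY" and "banach_space_over sd"
    and "continuous_embedding sY sX j"
    and "linear_operator sY sX DA A"
    and "linear_operator sY sd DA R" and "R ` DA = UNIV"
    and "bounded_operator sY sd B1" and "bounded_operator sY sd B2"
    and "bounded_operator sd sd B3" and "bounded_operator sd sd B4"
    and "closed_operator DA (\<lambda>u. (A u, R u))"
    and "generates_cosine_function sY sX j (ker_dom DA R) A"
    and "\<not> finite_dimensional sX"
  defines "a \<equiv> has_compact_resolvent (scale2 sY (scale2 sX (scale2 sd sd)))
                 (calA_dom j DA R) (calA j A R B1 B2 B3 B4)"
    and "b \<equiv> has_compact_resolvent (scale2 sY (scale2 sX sd))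
                 (bbA0_dom j DA R) (bbA0 j A B2)"
    and "c \<equiv> finite_dimensional sd \<and>
             compact_map (ker_dom DA R) (\<lambda>u. norm (j u) + norm (A u)) (\<lambda>u. u) \<and>
             compact_map UNIV norm j"
  shows "(a \<longleftrightarrow> b) \<and> (b \<longleftrightarrow> c)"
proof -
  interpret boundary_problem sX sY sd j DA A R B1 B2 B3 B4
    by unfold_locales (fact assms)+
  show ?thesis
    unfolding a_def b_def c_def
    using compact_resolvent_full_imp_small compact_resolvent_small_imp_compactness
      compactness_imp_compact_resolvent_full
    by blast
qed

end
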